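(* Let $g$ be the Kerr-Newman-(anti-)de Sitter metric with real parameters $a,m,q,\Lambda$ (see context), and let $I_6=l_\mu l^\mu$ with $l_\mu=-\nabla_\mu(C^*_{\alpha\beta\gamma\delta}C^{\alpha\beta\gamma\delta})$. Along the symmetry axis ($\theta=0$, $\theta=\pi$), $$\begin{aligned}I_6=-\frac{3072\left(\Lambda a^2r^2+\Lambda r^4-3a^2+6mr-3q^2-3r^2\right)}{(a^2+r^2)^{15}}\Big(&3m^2a^6-63r^2a^4m^2+32a^4mq^2r-2a^4q^4+105a^2m^2r^4\\&-120a^2mq^2r^3+28r^2a^2q^4-21m^2r^6+40mq^2r^5-18q^4r^4\Big)^2a^2,\end{aligned}$$ while in the equatorial plane $\theta=\frac{\pi}{2}$, for every value of $\Lambda$ (the same expression as for $\Lambda=0$), $$I_6=\frac{82944\left(mr-\frac{2q^2}{3}\right)^2\left(mr-q^2\right)^2a^2}{r^{20}}.$$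
   Context: Kerr-Newman-(anti-)de Sitter metric: in coordinates $(t,r,\theta,\phi)$, signature $(-,+,+,+)$, $$ds^2=-\frac{\Delta_r}{\Xi^2\rho^2}(dt-a\sin^2\theta\,d\phi)^2+\frac{\rho^2}{\Delta_r}dr^2+\frac{\rho^2}{\Delta_\theta}d\theta^2+\frac{\Delta_\theta\sin^2\theta}{\Xi^2\rho^2}\big(a\,dt-(r^2+a^2)d\phi\big)^2,$$ $\Delta_\theta=1+\frac{a^2\Lambda}{3}\cos^2\theta$, $\Xi=1+\frac{a^2\Lambda}{3}\neq0$, $\Delta_r=(1-\frac{\Lambda}{3}r^2)(r^2+a^2)-2mr+q^2$, $\rho^2=r^2+a^2\cos^2\theta$. $C_{\alpha\beta\gamma\delta}$ is the Weyl tensor of $g$, and $C^*_{\alpha\beta\gamma\delta}=\frac12E_{\alpha\beta\kappa\lambda}C^{\kappa\lambda}{}_{\gamma\delta}$ with $E$ the Levi-Civita pseudotensor ($I_6$ does not depend on the orientation). $I_6$ is a rational function of $(r,\cos\theta)$ with denominator a power of $\rho^2$; its value on the axis is obtained by continuity. *)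

theory Defs
  imports "HOL-Analysis.Analysis"
begin

section \<open>Tensor calculus in a coordinate chart of a four-dimensional spacetime\<close>

text \<open>
  A metric is given by its component matrix as a function of the coordinates.
  Tensor fields are families of component functions; the index type 4 has the elements
  1, 2, 3, 4 (with 4 = 0), in this order.
\<close>

type_synonym point = "real^4"
type_synonym metric = "point \<Rightarrow> real^4^4"

definition partial :: "4 \<Rightarrow> (point \<Rightarrow> real) \<Rightarrow> point \<Rightarrow> real" where
  "partial i f x = deriv (\<lambda>h. f (x + h *\<^sub>R axis i 1)) 0"

definition inv_metric :: "metric \<Rightarrow> metric" where
  "inv_metric g x = matrix_inv (g x)"

text \<open>\<open>christoffel g k i j\<close> has the upper index \<open>k\<close>.\<close>

definition christoffel :: "metric \<Rightarrow> 4 \<Rightarrow> 4 \<Rightarrow> 4 \<Rightarrow> point \<Rightarrow> real" where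
  "christoffel g k i j x =
     (1/2) * (\<Sum>d\<in>UNIV. inv_metric g x $ k $ d *
        (partial i (\<lambda>y. g y $ d $ j) x + partial j (\<lambda>y. g y $ d $ i) x
         - partial d (\<lambda>y. g y $ i $ j) x))"

text \<open>\<open>riemann_up g e b c d\<close> is the component with upper index \<open>e\<close> and lower indices \<open>b, c, d\<close>;
  the derivative indices are \<open>c, d\<close>. With this sign, round spheres have positive Ricci
  curvature.\<close>

definition riemann_up :: "metric \<Rightarrow> 4 \<Rightarrow> 4 \<Rightarrow> 4 \<Rightarrow> 4 \<Rightarrow> point \<Rightarrow> real" where
  "riemann_up g e b c d x =
     partial c (christoffel g e d b) x - partial d (christoffel g e c b) x
     + (\<Sum>f\<in>UNIV. christoffel g e c f x * christoffel g f d b x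
                   - christoffel g e d f x * christoffel g f c b x)"

definition riemann :: "metric \<Rightarrow> 4 \<Rightarrow> 4 \<Rightarrow> 4 \<Rightarrow> 4 \<Rightarrow> point \<Rightarrow> real" where
  "riemann g a b c d x = (\<Sum>e\<in>UNIV. g x $ a $ e * riemann_up g e b c d x)"

definition ricci :: "metric \<Rightarrow> 4 \<Rightarrow> 4 \<Rightarrow> point \<Rightarrow> real" where
  "ricci g b d x = (\<Sum>e\<in>UNIV. riemann_up g e b e d x)"

definition scalar_curvature :: "metric \<Rightarrow> point \<Rightarrow> real" where
  "scalar_curvature g x = (\<Sum>b\<in>UNIV. \<Sum>d\<in>UNIV. inv_metric g x $ b $ d * ricci g b d x)"

definition weyl :: "metric \<Rightarrow> 4 \<Rightarrow> 4 \<Rightarrow> 4 \<Rightarrow> 4 \<Rightarrow> point \<Rightarrow> real" where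
  "weyl g a b c d x =
     riemann g a b c d x
     - (1/2) * (g x $ a $ c * ricci g b d x - g x $ a $ d * ricci g b c x
                - g x $ b $ c * ricci g a d x + g x $ b $ d * ricci g a c x)
     + (1/6) * scalar_curvature g x * (g x $ a $ c * g x $ b $ d - g x $ a $ d * g x $ b $ c)"

text \<open>The first two indices of \<open>weyl_up2\<close> and all four indices of \<open>weyl_up4\<close> are upper.\<close>

definition weyl_up2 :: "metric \<Rightarrow> 4 \<Rightarrow> 4 \<Rightarrow> 4 \<Rightarrow> 4 \<Rightarrow> point \<Rightarrow> real" where
  "weyl_up2 g k l c d x =
     (\<Sum>a\<in>UNIV. \<Sum>b\<in>UNIV. inv_metric g x $ k $ a * inv_metric g x $ l $ b * weyl g a b c d x)"

definition weyl_up4 :: "metric \<Rightarrow> 4 \<Rightarrow> 4 \<Rightarrow> 4 \<Rightarrow> 4 \<Rightarrow> point \<Rightarrow> real" where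
  "weyl_up4 g k l m n x =
     (\<Sum>c\<in>UNIV. \<Sum>d\<in>UNIV. inv_metric g x $ m $ c * inv_metric g x $ n $ d * weyl_up2 g k l c d x)"

definition levi_civita_symbol :: "4 \<Rightarrow> 4 \<Rightarrow> 4 \<Rightarrow> 4 \<Rightarrow> real" where
  "levi_civita_symbol i j k l =
     (let p = (\<lambda>n. (vector [i, j, k, l] :: 4^4) $ n)
      in if p permutes UNIV then of_int (sign p) else 0)"

text \<open>The orientation is the one in which the coordinate frame is positive.\<close>

definition levi_civita :: "metric \<Rightarrow> 4 \<Rightarrow> 4 \<Rightarrow> 4 \<Rightarrow> 4 \<Rightarrow> point \<Rightarrow> real" where
  "levi_civita g i j k l x = sqrt \<bar>det (g x)\<bar> * levi_civita_symbol i j k l"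

definition dual_weyl :: "metric \<Rightarrow> 4 \<Rightarrow> 4 \<Rightarrow> 4 \<Rightarrow> 4 \<Rightarrow> point \<Rightarrow> real" where
  "dual_weyl g a b c d x =
     (1/2) * (\<Sum>k\<in>UNIV. \<Sum>l\<in>UNIV. levi_civita g a b k l x * weyl_up2 g k l c d x)"

definition dual_weyl_weyl :: "metric \<Rightarrow> point \<Rightarrow> real" where
  "dual_weyl_weyl g x =
     (\<Sum>a\<in>UNIV. \<Sum>b\<in>UNIV. \<Sum>c\<in>UNIV. \<Sum>d\<in>UNIV. dual_weyl g a b c d x * weyl_up4 g a b c d x)"

text \<open>On scalars the covariant derivative is the partial derivative.\<close>

definition l_covector :: "metric \<Rightarrow> 4 \<Rightarrow> point \<Rightarrow> real" where
  "l_covector g \<mu> x = - partial \<mu> (dual_weyl_weyl g) x"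

definition I6 :: "metric \<Rightarrow> point \<Rightarrow> real" where
  "I6 g x = (\<Sum>\<mu>\<in>UNIV. \<Sum>\<nu>\<in>UNIV.
     inv_metric g x $ \<mu> $ \<nu> * l_covector g \<mu> x * l_covector g \<nu> x)"


section \<open>The Kerr-Newman-(anti-)de Sitter metric\<close>

text \<open>The coordinates of a point \<open>x\<close> are \<open>x $ 1 = t\<close>, \<open>x $ 2 = r\<close>, \<open>x $ 3 = \<theta>\<close>, \<open>x $ 4 = \<phi>\<close>.\<close>

definition Xi :: "real \<Rightarrow> real \<Rightarrow> real" where
  "Xi a \<Lambda> = 1 + a^2 * \<Lambda> / 3"

definition Delta_theta :: "real \<Rightarrow> real \<Rightarrow> real \<Rightarrow> real" where
  "Delta_theta a \<Lambda> \<theta> = 1 + a^2 * \<Lambda> / 3 * (cos \<theta>)^2"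

definition Delta_r :: "real \<Rightarrow> real \<Rightarrow> real \<Rightarrow> real \<Rightarrow> real \<Rightarrow> real" where
  "Delta_r a m q \<Lambda> r = (1 - \<Lambda> / 3 * r^2) * (r^2 + a^2) - 2 * m * r + q^2"

definition rho2 :: "real \<Rightarrow> real \<Rightarrow> real \<Rightarrow> real" where
  "rho2 a r \<theta> = r^2 + a^2 * (cos \<theta>)^2"

text \<open>The four summands of the line element are multiples of squares of one-forms; the
  one-forms \<open>dt - a sin\<^sup>2 \<theta> d\<phi>\<close> and \<open>a dt - (r\<^sup>2 + a\<^sup>2) d\<phi>\<close> are \<open>\<omega>\<close> and \<open>\<eta>\<close>.\<close>

definition kn_metric :: "real \<Rightarrow> real \<Rightarrow> real \<Rightarrow> real \<Rightarrow> metric" where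
  "kn_metric a m q \<Lambda> x =
     (let r = x $ 2; \<theta> = x $ 3;
          \<omega> = (vector [1, 0, 0, - a * (sin \<theta>)^2] :: real^4);
          dr = (axis 2 1 :: real^4);
          d\<theta> = (axis 3 1 :: real^4);
          \<eta> = (vector [a, 0, 0, - (r^2 + a^2)] :: real^4)
      in \<chi> i j.
          - Delta_r a m q \<Lambda> r / ((Xi a \<Lambda>)^2 * rho2 a r \<theta>) * (\<omega> $ i * \<omega> $ j)
          + rho2 a r \<theta> / Delta_r a m q \<Lambda> r * (dr $ i * dr $ j)
          + rho2 a r \<theta> / Delta_theta a \<Lambda> \<theta> * (d\<theta> $ i * d\<theta> $ j)
          + Delta_theta a \<Lambda> \<theta> * (sin \<theta>)^2 / ((Xi a \<Lambda>)^2 * rho2 a r \<theta>) * (\<eta> $ i * \<eta> $ j))"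

text \<open>The open set on which the coordinate expression of the metric is smooth and nondegenerate:
  it omits the axis, the zeros of \<open>Delta_r\<close> (horizons) and, if \<open>Xi a \<Lambda> < 0\<close>, those of
  \<open>Delta_theta\<close>.\<close>

definition kn_chart :: "real \<Rightarrow> real \<Rightarrow> real \<Rightarrow> real \<Rightarrow> point set" where
  "kn_chart a m q \<Lambda> =
     {x. 0 < x $ 3 \<and> x $ 3 < pi \<and> rho2 a (x $ 2) (x $ 3) \<noteq> 0 \<and>
         Delta_r a m q \<Lambda> (x $ 2) \<noteq> 0 \<and> Delta_theta a \<Lambda> (x $ 3) \<noteq> 0}"

text \<open>\<open>f\<close> has the value \<open>v\<close> at \<open>p\<close>, either literally (if \<open>p\<close> is in the domain \<open>S\<close> of \<open>f\<close>) or by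
  continuous extension. The limit-point condition excludes vacuous limits.\<close>

definition value_by_continuity ::
    "('a::topological_space \<Rightarrow> real) \<Rightarrow> 'a set \<Rightarrow> 'a \<Rightarrow> real \<Rightarrow> bool" where
  "value_by_continuity f S p v \<longleftrightarrow>
     (if p \<in> S then f p = v else p islimpt S \<and> (f \<longlongrightarrow> v) (at p within S))"

end

theory Submission
  imports Defs
begin

text \<open>
  With \<open>c = cos \<theta>\<close> and \<open>u = r\<^sup>2 + a\<^sup>2 c\<^sup>2\<close>, the one-forms \<open>\<omega> / \<Xi>\<close>, \<open>dr\<close>, \<open>dc\<close>, \<open>\<eta> / \<Xi>\<close> form a coframe
  whose dual vectors are orthogonal with squared norms \<open>- R / u\<close>, \<open>u / R\<close>, \<open>u / Q\<close>, \<open>Q / u\<close>, rational in \<open>R = \<Delta>\<^sub>r\<close> and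
  \<open>Q = \<Delta>\<^sub>\<theta> (1 - c\<^sup>2)\<close>, so that no square roots and no signs of \<open>\<Delta>\<^sub>r\<close>, \<open>\<Delta>\<^sub>\<theta>\<close> enter. In this frame the Weyl
  tensor has type D form with two scalars \<open>X\<close>, \<open>Y\<close>, and the dual contraction is \<open>96 X Y\<close>. For the
  actual \<open>R\<close> and \<open>Q\<close> one gets \<open>u\<^sup>3 (X - i Y) = (q\<^sup>2 - m w) w\<^sup>2\<close> with \<open>w = r + i a c\<close>, independently of \<open>\<Lambda>\<close>.
  Hence \<open>I\<^sub>6 = (R k\<^sub>r\<^sup>2 + Q k\<^sub>c\<^sup>2) / u\<close> for \<open>k = 96 X Y\<close>, an expression continuous in \<open>(r, c)\<close> wherever
  \<open>u \<noteq> 0\<close>. On the axis \<open>Q = 0\<close>, and in the equatorial plane \<open>k\<^sub>r = 0\<close> because \<open>k\<close> is odd in \<open>c\<close>.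
\<close>

section \<open>Permutation sums, partial derivatives\<close>

text \<open>Unfolding the definitions of curvature for this metric in coordinates gives expressions
  too large to handle. The curvature is therefore expressed once, for an abstract orthogonal frame,
  through connection coefficients. These never have to be derived: the Levi-Civita connection is the
  only one that is torsion-free and metric, so it suffices to write down a table of coefficients and
  check these two conditions. The second device is to keep \<open>R\<close> and \<open>Q\<close>
  arbitrary. Their values and first and second derivatives then act as independent atoms, and each
  curvature component becomes one rational identity in these atoms, \<open>r\<close>,
  \<open>c\<close> and \<open>a\<close>, free of \<open>m\<close>, \<open>q\<close>,
  \<open>\<Lambda>\<close>. The parameters enter only at the end, where all that remains is to
  evaluate two scalars.\<close>

lemma vector_4 [simp]:
  "(vector [a, b, c, d] :: 'a::zero^4) $ 1 = a" "(vector [a, b, c, d] :: 'a^4) $ 2 = b"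
  "(vector [a, b, c, d] :: 'a^4) $ 3 = c" "(vector [a, b, c, d] :: 'a^4) $ 4 = d"
  unfolding vector_def by simp_all

text \<open>Quadruples of indices are tabulated functions on the four-element index type, and the
  symbol vanishes on those that are not permutations; 256 terms thus reduce to 24 signed
  ones.\<close>

lemma sum_levi_civita_permutations:
  "(\<Sum>i\<in>UNIV. \<Sum>j\<in>UNIV. \<Sum>k\<in>UNIV. \<Sum>l\<in>UNIV. levi_civita_symbol i j k l * f i j k l)
   = (\<Sum>p | p permutes (UNIV :: 4 set). of_int (sign p) * f (p 1) (p 2) (p 3) (p 4))"
proof -
  define tup where "tup = (\<lambda>p :: 4 \<Rightarrow> 4. (p 1, p 2, p 3, p 4))"
  define fn where "fn = (\<lambda>(i, j, k, l). (\<lambda>n. (vector [i, j, k, l] :: 4^4) $ n))"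
  have fn_tup: "fn (tup p) = p" for p
  proof
    fix n :: 4
    show "fn (tup p) n = p n"
      unfolding fn_def tup_def using exhaust_4[of n] by auto
  qed
  have tup_fn: "tup (fn t) = t" for t
    unfolding fn_def tup_def by (cases t) simp
  have "(\<Sum>i\<in>UNIV. \<Sum>j\<in>UNIV. \<Sum>k\<in>UNIV. \<Sum>l\<in>UNIV. levi_civita_symbol i j k l * f i j k l)
    = (\<Sum>t\<in>UNIV. case t of (i, j, k, l) \<Rightarrow> levi_civita_symbol i j k l * f i j k l)"
    by (simp add: sum.cartesian_product)
  also have "\<dots> = (\<Sum>t | fn t permutes UNIV. case t of (i, j, k, l) \<Rightarrow> of_int (sign (fn t)) * f i j k l)"
    by (rule sum.mono_neutral_cong_right) (auto simp: levi_civita_symbol_def fn_def Let_def split: if_splits)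
  also have "\<dots> = (\<Sum>p | p permutes (UNIV :: 4 set). of_int (sign p) * f (p 1) (p 2) (p 3) (p 4))"
    by (rule sum.reindex_bij_witness[where i = tup and j = fn])
       (auto simp: fn_tup tup_fn, auto simp: fn_def)
  finally show ?thesis .
qed

lemma sum_levi_civita:
  "(\<Sum>i\<in>UNIV. \<Sum>j\<in>UNIV. \<Sum>k\<in>UNIV. \<Sum>l\<in>UNIV. levi_civita_symbol i j k l * f i j k l)
   = f 1 2 3 4 - f 1 2 4 3 - f 1 3 2 4 + f 1 3 4 2 + f 1 4 2 3 - f 1 4 3 2
     - f 2 1 3 4 + f 2 1 4 3 + f 2 3 1 4 - f 2 3 4 1 - f 2 4 1 3 + f 2 4 3 1
     + f 3 1 2 4 - f 3 1 4 2 - f 3 2 1 4 + f 3 2 4 1 + f 3 4 1 2 - f 3 4 2 1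
     - f 4 1 2 3 + f 4 1 3 2 + f 4 2 1 3 - f 4 2 3 1 - f 4 3 1 2 + f 4 3 2 1"
proof -
  have f: "finite {2::4, 3, 4}" "1 \<notin> {2::4, 3, 4}" "finite {3::4, 4}" "2 \<notin> {3::4, 4}"
    "finite {4::4}" "3 \<notin> {4::4}"
    by auto
  show ?thesis
    unfolding sum_levi_civita_permutations
    unfolding UNIV_4
    \<comment> \<open>Each rewriting splits off one element: a permutation of the larger set is a
      transposition composed with a permutation of the smaller one, so all signs come from
      transpositions.\<close>
    unfolding sum_over_permutations_insert[OF f(1,2)] sum_over_permutations_insert[OF f(3,4)]
      sum_over_permutations_insert[OF f(5,6)] permutes_sing
    by (simp add: sign_swap_id permutation_swap_id sign_compose sign_id swap_id_eq
        permutation_compose)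
qed

text \<open>Testing the 24-term expansion against the indicator of a single quadruple reads off the
  value of the symbol, without computing the sign of an individual permutation.\<close>

lemma levi_civita_symbol_eq:
  "levi_civita_symbol i j k l =
    (let f = (\<lambda>i' j' k' l'. of_bool (i = i' \<and> j = j' \<and> k = k' \<and> l = l')) in
     f 1 2 3 4 - f 1 2 4 3 - f 1 3 2 4 + f 1 3 4 2 + f 1 4 2 3 - f 1 4 3 2
     - f 2 1 3 4 + f 2 1 4 3 + f 2 3 1 4 - f 2 3 4 1 - f 2 4 1 3 + f 2 4 3 1
     + f 3 1 2 4 - f 3 1 4 2 - f 3 2 1 4 + f 3 2 4 1 + f 3 4 1 2 - f 3 4 2 1
     - f 4 1 2 3 + f 4 1 3 2 + f 4 2 1 3 - f 4 2 3 1 - f 4 3 1 2 + f 4 3 2 1)"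
proof -
  let ?f = "\<lambda>i' j' k' l'. of_bool (i = i' \<and> j = j' \<and> k = k' \<and> l = l') :: real"
  have single: "sum h UNIV = h n" if "\<And>n'. n' \<noteq> n \<Longrightarrow> h n' = 0" for h :: "4 \<Rightarrow> real" and n
    using that by (subst sum.remove[of _ n]) (auto intro: sum.neutral)
  have "(\<Sum>i'\<in>UNIV. \<Sum>j'\<in>UNIV. \<Sum>k'\<in>UNIV. \<Sum>l'\<in>UNIV. levi_civita_symbol i' j' k' l' * ?f i' j' k' l')
    = (\<Sum>j'\<in>UNIV. \<Sum>k'\<in>UNIV. \<Sum>l'\<in>UNIV. levi_civita_symbol i j' k' l' * ?f i j' k' l')"
    by (rule single) simp
  also have "\<dots> = (\<Sum>k'\<in>UNIV. \<Sum>l'\<in>UNIV. levi_civita_symbol i j k' l' * ?f i j k' l')"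
    by (rule single) simp
  also have "\<dots> = (\<Sum>l'\<in>UNIV. levi_civita_symbol i j k l' * ?f i j k l')"
    by (rule single) simp
  also have "\<dots> = levi_civita_symbol i j k l"
    by (subst single[of l]) simp_all
  finally show ?thesis
    unfolding sum_levi_civita Let_def by (rule sym)
qed

lemma prod_4: "prod f (UNIV :: 4 set) = f 1 * f 2 * f 3 * f 4"
  unfolding UNIV_4 by (simp add: ac_simps)

text \<open>The sum is the Leibniz expansion for the matrix whose rows are the rows
  \<open>a\<close>, \<open>b\<close>, \<open>c\<close>, \<open>d\<close> of \<open>M\<close>.
  Permuted rows contribute the sign, a repeated row gives 0.\<close>

lemma sum_levi_civita_rows:
  fixes M :: "4 \<Rightarrow> 4 \<Rightarrow> real"
  shows "(\<Sum>i\<in>UNIV. \<Sum>j\<in>UNIV. \<Sum>k\<in>UNIV. \<Sum>l\<in>UNIV. levi_civita_symbol i j k l * (M a i * M b j * M c k * M d l))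
   = levi_civita_symbol a b c d * det (\<chi> i j. M i j)"
proof -
  define v where "v = (\<lambda>n. (vector [a, b, c, d] :: 4^4) $ n)"
  have v: "v 1 = a" "v 2 = b" "v 3 = c" "v 4 = d"
    by (simp_all add: v_def)
  have "(\<Sum>i\<in>UNIV. \<Sum>j\<in>UNIV. \<Sum>k\<in>UNIV. \<Sum>l\<in>UNIV. levi_civita_symbol i j k l * (M a i * M b j * M c k * M d l))
    = det (\<chi> n. (\<chi> i j. M i j) $ v n)"
    unfolding sum_levi_civita_permutations det_def
    by (rule sum.cong) (simp_all add: prod_4 v mult.assoc)
  also have "\<dots> = levi_civita_symbol a b c d * det (\<chi> i j. M i j)"
  proof (cases "v permutes UNIV")
    case True
    then show ?thesis
      by (subst det_permute_rows) (simp_all add: levi_civita_symbol_def flip: v_def)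
  next
    case False
    have "\<not> inj v"
    proof
      assume "inj v"
      then have "bij v"
        by (simp add: bij_def finite_UNIV_inj_surj)
      then show False
        using False by (simp add: permutes_univ bij_iff)
    qed
    then obtain n n' where "n \<noteq> n'" "v n = v n'"
      by (auto simp: inj_def)
    then have "det (\<chi> n. (\<chi> i j. M i j) $ v n) = 0"
      by (intro det_identical_rows[of n n']) (simp_all add: row_def)
    then show ?thesis
      using False by (simp add: levi_civita_symbol_def flip: v_def)
  qed
  finally show ?thesis .
qed

text \<open>\<open>matrix_inv\<close> is a Hilbert choice; since a right inverse of a square matrix
  is also a left inverse, the choice is forced.\<close>

lemma matrix_inv_eqI:
  fixes A B :: "real^'n^'n"
  assumes "A ** B = mat 1"
  shows "matrix_inv A = B"
proof -
  have "B ** A = mat 1"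
    using assms by (simp add: matrix_left_right_inverse)
  then have "\<exists>A'. A ** A' = mat 1 \<and> A' ** A = mat 1"
    using assms by blast
  then have "A ** matrix_inv A = mat 1"
    unfolding matrix_inv_def by (rule someI2_ex) simp
  then have "B ** (A ** matrix_inv A) = B"
    by simp
  then show ?thesis
    by (simp add: matrix_mul_assoc \<open>B ** A = mat 1\<close>)
qed

text \<open>\<open>deriv\<close>, and with it \<open>partial\<close>, is total and says nothing
  where no derivative exists. This relation carries existence together with the value, which the sum
  and product rules require.\<close>

definition has_partial :: "(point \<Rightarrow> real) \<Rightarrow> 4 \<Rightarrow> real \<Rightarrow> point \<Rightarrow> bool" where
  "has_partial f i d x \<longleftrightarrow> ((\<lambda>h. f (x + h *\<^sub>R axis i 1)) has_real_derivative d) (at 0)"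

lemma partial_eqI: "has_partial f i d x \<Longrightarrow> partial i f x = d"
  unfolding has_partial_def partial_def by (rule DERIV_imp_deriv)

lemma has_partial_const: "has_partial (\<lambda>y. c) i 0 x"
  unfolding has_partial_def by simp

lemma has_partial_add:
  "has_partial f i d x \<Longrightarrow> has_partial f' i d' x \<Longrightarrow> has_partial (\<lambda>y. f y + f' y) i (d + d') x"
  unfolding has_partial_def by (rule DERIV_add)

lemma has_partial_mult:
  "has_partial f i d x \<Longrightarrow> has_partial f' i d' x \<Longrightarrow>
    has_partial (\<lambda>y. f y * f' y) i (d * f' x + f x * d') x"
  unfolding has_partial_def by (auto intro!: derivative_eq_intros)

lemma has_partial_sum:
  "(\<And>a. a \<in> A \<Longrightarrow> has_partial (f a) i (d a) x) \<Longrightarrow>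
    has_partial (\<lambda>y. \<Sum>a\<in>A. f a y) i (\<Sum>a\<in>A. d a) x"
  unfolding has_partial_def by (rule DERIV_sum)

lemma eventually_on_coordinate_line:
  fixes x :: point
  assumes "open U" "x \<in> U"
  shows "\<forall>\<^sub>F h in nhds 0. x + h *\<^sub>R axis i 1 \<in> U"
proof -
  have "isCont (\<lambda>h. x + h *\<^sub>R axis i 1) 0"
    by (intro continuous_intros)
  then have "((\<lambda>h. x + h *\<^sub>R axis i 1) \<longlongrightarrow> x) (nhds 0)"
    using tendsto_at_iff_tendsto_nhds[of "\<lambda>h. x + h *\<^sub>R axis i 1" 0] by (simp add: continuous_at)
  then show ?thesis
    using assms by (auto simp: tendsto_def)
qed

text \<open>The frame formulas for the metric and its Christoffel symbols hold only on an open set.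
  A derivative along a coordinate line sees only nearby points, so these formulas may still be
  differentiated.\<close>

lemma has_partial_cong:
  assumes "open U" "x \<in> U" "\<And>y. y \<in> U \<Longrightarrow> f y = f' y"
  shows "has_partial f i d x \<longleftrightarrow> has_partial f' i d x"
  unfolding has_partial_def
  by (rule DERIV_cong_ev)
     (use eventually_on_coordinate_line[OF assms(1,2), of i] in \<open>auto elim!: eventually_mono simp: assms(3)\<close>)

section \<open>Orthogonal frames\<close>

text \<open>The symbol is a tensor density: moving all four indices to another frame costs exactly
  one determinant.\<close>

lemma sum_levi_civita_transform:
  fixes M :: "4 \<Rightarrow> 4 \<Rightarrow> real"
  shows "(\<Sum>i\<in>UNIV. \<Sum>j\<in>UNIV. \<Sum>k\<in>UNIV. \<Sum>l\<in>UNIV. levi_civita_symbol i j k l *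
      (\<Sum>a\<in>UNIV. \<Sum>b\<in>UNIV. \<Sum>c\<in>UNIV. \<Sum>d\<in>UNIV. M a i * M b j * M c k * M d l * t a b c d))
    = det (\<chi> i j. M i j) *
      (\<Sum>a\<in>UNIV. \<Sum>b\<in>UNIV. \<Sum>c\<in>UNIV. \<Sum>d\<in>UNIV. levi_civita_symbol a b c d * t a b c d)"
proof -
  have *: "(\<Sum>(i, j, k, l)\<in>UNIV. levi_civita_symbol i j k l * (M a i * M b j * M c k * M d l))
      = levi_civita_symbol a b c d * det (\<chi> i j. M i j)" for a b c d
    using sum_levi_civita_rows[of M a b c d] by (simp add: sum.cartesian_product)
  have "(\<Sum>(i, j, k, l)\<in>UNIV. levi_civita_symbol i j k l *
      (\<Sum>(a, b, c, d)\<in>UNIV. M a i * M b j * M c k * M d l * t a b c d))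
    = (\<Sum>(a, b, c, d)\<in>UNIV. t a b c d *
        (\<Sum>(i, j, k, l)\<in>UNIV. levi_civita_symbol i j k l * (M a i * M b j * M c k * M d l)))"
    unfolding sum_distrib_left case_prod_unfold
    by (subst sum.swap) (simp add: ac_simps)
  also have "\<dots> = det (\<chi> i j. M i j) * (\<Sum>(a, b, c, d)\<in>UNIV. levi_civita_symbol a b c d * t a b c d)"
    unfolding * by (simp add: sum_distrib_left case_prod_unfold ac_simps)
  finally show ?thesis
    by (simp add: sum.cartesian_product)
qed

text \<open>\<open>E A i\<close> and \<open>e A i\<close> are the coordinate components of the \<open>A\<close>-th coframe form and frame vector, \<open>G A\<close> is
  the squared norm of \<open>e A\<close>, and \<open>DG C\<close>, \<open>D\<gamma> C\<close> are derivatives along \<open>e C\<close>. The connection is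
  \<open>\<nabla>\<^bsub>e C\<^esub> (e B) = (\<Sum>A. \<gamma> A B C e A)\<close>.\<close>

locale orthogonal_frame =
  fixes g :: metric and U :: "point set"
    and E e :: "4 \<Rightarrow> 4 \<Rightarrow> point \<Rightarrow> real"
    and dE :: "4 \<Rightarrow> 4 \<Rightarrow> 4 \<Rightarrow> point \<Rightarrow> real"
    and ddE :: "4 \<Rightarrow> 4 \<Rightarrow> 4 \<Rightarrow> 4 \<Rightarrow> point \<Rightarrow> real"
    and G :: "4 \<Rightarrow> point \<Rightarrow> real"
    and DG :: "4 \<Rightarrow> 4 \<Rightarrow> point \<Rightarrow> real"
    and \<gamma> :: "4 \<Rightarrow> 4 \<Rightarrow> 4 \<Rightarrow> point \<Rightarrow> real"
    and D\<gamma> :: "4 \<Rightarrow> 4 \<Rightarrow> 4 \<Rightarrow> 4 \<Rightarrow> point \<Rightarrow> real"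
  assumes open_U: "open U"
    and dual: "x \<in> U \<Longrightarrow> (\<Sum>k\<in>UNIV. E A k x * e B k x) = (if A = B then 1 else 0)"
    and metric_eq: "x \<in> U \<Longrightarrow> g x $ i $ j = (\<Sum>A\<in>UNIV. G A x * E A i x * E A j x)"
    and G_nonzero: "x \<in> U \<Longrightarrow> G A x \<noteq> 0"
    and dE: "x \<in> U \<Longrightarrow> has_partial (E A j) i (dE i A j x) x"
    and ddE: "x \<in> U \<Longrightarrow> has_partial (dE i A j) k (ddE k i A j x) x"
    and ddE_commute: "x \<in> U \<Longrightarrow> ddE k i A j x = ddE i k A j x"
    and de: "x \<in> U \<Longrightarrow> \<exists>d. has_partial (e A k) i d x"
    and DG: "x \<in> U \<Longrightarrow> has_partial (G A) i (\<Sum>C\<in>UNIV. E C i x * DG C A x) x"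
    and D\<gamma>: "x \<in> U \<Longrightarrow> has_partial (\<gamma> A B K) i (\<Sum>C\<in>UNIV. E C i x * D\<gamma> C A B K x) x"
    and torsion_free: "x \<in> U \<Longrightarrow> dE i A j x - dE j A i x
      = (\<Sum>C\<in>UNIV. \<Sum>D\<in>UNIV. E C i x * E D j x * (\<gamma> A C D x - \<gamma> A D C x))"
    and compatible: "x \<in> U \<Longrightarrow>
      G A x * \<gamma> A B C x + G B x * \<gamma> B A C x = (if A = B then DG C A x else 0)"
begin

section \<open>Conversion between frame and coordinate components\<close>

definition low :: "point \<Rightarrow> (4 \<Rightarrow> real) \<Rightarrow> 4 \<Rightarrow> real" where
  "low x f a = (\<Sum>A\<in>UNIV. E A a x * f A)"

definition up :: "point \<Rightarrow> (4 \<Rightarrow> real) \<Rightarrow> 4 \<Rightarrow> real" where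
  "up x f a = (\<Sum>A\<in>UNIV. e A a x * f A)"

lemma dual': "x \<in> U \<Longrightarrow> (\<Sum>A\<in>UNIV. E A k x * e A l x) = (if k = l then 1 else 0)"
proof -
  assume x: "x \<in> U"
  define M N where "M = (\<chi> A k. E A k x)" and "N = (\<chi> k A. e A k x)"
  have "M ** N = mat 1"
    using dual[OF x] by (simp add: M_def N_def matrix_matrix_mult_def mat_def vec_eq_iff)
  then have "N ** M = mat 1"
    by (simp add: matrix_left_right_inverse)
  then have "(N ** M) $ l $ k = mat 1 $ l $ k"
    by simp
  then show ?thesis
    by (simp add: M_def N_def matrix_matrix_mult_def mat_def mult.commute eq_commute)
qed

lemma coframe_up: "x \<in> U \<Longrightarrow> (\<Sum>k\<in>UNIV. E A k x * up x f k) = f A"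
proof -
  assume x: "x \<in> U"
  have "(\<Sum>k\<in>UNIV. E A k x * up x f k) = (\<Sum>B\<in>UNIV. (\<Sum>k\<in>UNIV. E A k x * e B k x) * f B)"
    unfolding up_def sum_distrib_left sum_distrib_right by (subst sum.swap) (simp add: ac_simps)
  then show ?thesis
    by (simp add: dual[OF x] if_distrib[of "\<lambda>c. c * _"] cong: if_cong)
qed

lemma frame_low: "x \<in> U \<Longrightarrow> (\<Sum>k\<in>UNIV. e A k x * low x f k) = f A"
proof -
  assume x: "x \<in> U"
  have "(\<Sum>k\<in>UNIV. e A k x * low x f k) = (\<Sum>B\<in>UNIV. (\<Sum>k\<in>UNIV. E B k x * e A k x) * f B)"
    unfolding low_def sum_distrib_left sum_distrib_right by (subst sum.swap) (simp add: ac_simps)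
  then show ?thesis
    by (simp add: dual[OF x] if_distrib[of "\<lambda>c. c * _"] cong: if_cong)
qed

lemma up_coframe: "x \<in> U \<Longrightarrow> up x (\<lambda>A. \<Sum>k\<in>UNIV. E A k x * f k) l = f l"
proof -
  assume x: "x \<in> U"
  have "up x (\<lambda>A. \<Sum>k\<in>UNIV. E A k x * f k) l = (\<Sum>k\<in>UNIV. (\<Sum>A\<in>UNIV. E A k x * e A l x) * f k)"
    unfolding up_def sum_distrib_left sum_distrib_right by (subst sum.swap) (simp add: ac_simps)
  then show ?thesis
    by (simp add: dual'[OF x] if_distrib[of "\<lambda>c. c * _"] cong: if_cong)
qed

lemma low_up_pairing: "x \<in> U \<Longrightarrow> (\<Sum>k\<in>UNIV. low x f k * up x h k) = (\<Sum>A\<in>UNIV. f A * h A)"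
proof -
  assume x: "x \<in> U"
  have "(\<Sum>k\<in>UNIV. low x f k * up x h k) = (\<Sum>A\<in>UNIV. f A * (\<Sum>k\<in>UNIV. E A k x * up x h k))"
    unfolding low_def sum_distrib_left sum_distrib_right by (subst sum.swap) (simp add: ac_simps)
  then show ?thesis
    by (simp add: coframe_up[OF x])
qed

lemma metric_up:
  "x \<in> U \<Longrightarrow> (\<Sum>k\<in>UNIV. g x $ i $ k * up x f k) = low x (\<lambda>A. G A x * f A) i"
proof -
  assume x: "x \<in> U"
  have "(\<Sum>k\<in>UNIV. g x $ i $ k * up x f k)
      = (\<Sum>A\<in>UNIV. E A i x * (G A x * (\<Sum>k\<in>UNIV. E A k x * up x f k)))"
    unfolding metric_eq[OF x] sum_distrib_left sum_distrib_right
    by (subst sum.swap) (simp add: ac_simps)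
  then show ?thesis
    by (simp add: coframe_up[OF x] low_def)
qed

text \<open>Lowering an index scales the \<open>A\<close>-th frame component by \<open>G A\<close>,
  so the inverse has to scale it by the reciprocal; this candidate is verified by multiplication
  with the metric.\<close>

lemma inv_metric_eq:
  "x \<in> U \<Longrightarrow> inv_metric g x $ k $ l = (\<Sum>A\<in>UNIV. e A k x * e A l x / G A x)"
proof -
  assume x: "x \<in> U"
  have "inv_metric g x = (\<chi> k l. up x (\<lambda>A. e A l x / G A x) k)"
    unfolding inv_metric_def
    by (rule matrix_inv_eqI)
       (simp add: vec_eq_iff matrix_matrix_mult_def mat_def metric_up[OF x] G_nonzero[OF x] low_def
         dual'[OF x])
  then show ?thesis
    by (simp add: up_def)
qed

lemma inv_metric_low:
  "x \<in> U \<Longrightarrow> (\<Sum>k\<in>UNIV. inv_metric g x $ l $ k * low x f k) = up x (\<lambda>A. f A / G A x) l"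
proof -
  assume x: "x \<in> U"
  have "(\<Sum>k\<in>UNIV. inv_metric g x $ l $ k * low x f k)
      = (\<Sum>A\<in>UNIV. e A l x * ((\<Sum>k\<in>UNIV. e A k x * low x f k) / G A x))"
    unfolding inv_metric_eq[OF x] sum_distrib_left sum_distrib_right sum_divide_distrib
    by (subst sum.swap) (simp add: ac_simps)
  then show ?thesis
    by (simp add: frame_low[OF x] up_def)
qed

text \<open>A tensor with several indices is a nest of \<open>low\<close> and \<open>up\<close>, one
  application per index. Two tensors can be added or compared only when nested in the same order,
  hence the exchange rules.\<close>

lemma low_swap: "low x (\<lambda>A. low x (f A) b) a = low x (\<lambda>B. low x (\<lambda>A. f A B) a) b"
  unfolding low_def sum_distrib_left by (subst sum.swap) (simp add: ac_simps)

lemma up_low_swap: "up x (\<lambda>A. low x (f A) b) a = low x (\<lambda>B. up x (\<lambda>A. f A B) a) b"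
  unfolding low_def up_def sum_distrib_left by (subst sum.swap) (simp add: ac_simps)

lemma low_add: "low x f a + low x h a = low x (\<lambda>A. f A + h A) a"
  unfolding low_def by (simp add: distrib_left sum.distrib)

lemma low_diff: "low x f a - low x h a = low x (\<lambda>A. f A - h A) a"
  unfolding low_def by (simp add: right_diff_distrib sum_subtractf)

lemma mult_low: "c * low x f a = low x (\<lambda>A. c * f A) a"
  unfolding low_def sum_distrib_left by (simp add: ac_simps)

lemma sum_low: "(\<Sum>k\<in>K. low x (f k) a) = low x (\<lambda>A. \<Sum>k\<in>K. f k A) a"
  unfolding low_def sum_distrib_left by (rule sum.swap)

lemma trace_low_up:
  "x \<in> U \<Longrightarrow> (\<Sum>k\<in>UNIV. low x (\<lambda>C. up x (\<lambda>A. f A C) k) k) = (\<Sum>A\<in>UNIV. f A A)"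
proof -
  assume x: "x \<in> U"
  have "(\<Sum>k\<in>UNIV. low x (\<lambda>C. up x (\<lambda>A. f A C) k) k)
      = (\<Sum>C\<in>UNIV. \<Sum>k\<in>UNIV. E C k x * up x (\<lambda>A. f A C) k)"
    unfolding low_def by (rule sum.swap)
  then show ?thesis
    by (simp add: coframe_up[OF x])
qed

text \<open>The Christoffel symbols with the upper index referred to the frame.\<close>

definition H :: "4 \<Rightarrow> 4 \<Rightarrow> 4 \<Rightarrow> point \<Rightarrow> real" where
  "H A i j x = dE i A j x + (\<Sum>C\<in>UNIV. \<Sum>B\<in>UNIV. E C i x * E B j x * \<gamma> A B C x)"

text \<open>This is where \<open>torsion_free\<close> enters: the antisymmetric part of the coframe
  derivatives is cancelled by that of the connection coefficients.\<close>

lemma H_commute: "x \<in> U \<Longrightarrow> H A i j x = H A j i x"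
proof -
  assume x: "x \<in> U"
  have "(\<Sum>C\<in>UNIV. \<Sum>B\<in>UNIV. E C j x * E B i x * \<gamma> A B C x)
      = (\<Sum>C\<in>UNIV. \<Sum>B\<in>UNIV. E C i x * E B j x * \<gamma> A C B x)"
    by (subst sum.swap) (simp add: ac_simps)
  then have "H A i j x - H A j i x = (dE i A j x - dE j A i x)
      - (\<Sum>C\<in>UNIV. \<Sum>B\<in>UNIV. E C i x * E B j x * (\<gamma> A C B x - \<gamma> A B C x))"
    by (simp add: H_def right_diff_distrib sum_subtractf)
  then show ?thesis
    by (simp add: torsion_free[OF x])
qed

text \<open>This is the vanishing of the covariant derivative of the metric, solved for the partial
  derivative, with \<open>H\<close> in the role of the Christoffel symbols.\<close>

lemma partial_metric:
  "x \<in> U \<Longrightarrow> partial i (\<lambda>y. g y $ d $ j) x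
    = (\<Sum>A\<in>UNIV. G A x * (E A d x * H A i j x + E A j x * H A i d x))"
proof -
  assume x: "x \<in> U"
  have H_diff: "H A i j x - dE i A j x = (\<Sum>B\<in>UNIV. \<Sum>C\<in>UNIV. E C i x * E B j x * \<gamma> A B C x)" for A j
    unfolding H_def by (simp add: sum.swap[of "\<lambda>C B. E C i x * E B j x * \<gamma> A B C x"])
  have "has_partial (\<lambda>y. g y $ d $ j) i (\<Sum>A\<in>UNIV. ((\<Sum>C\<in>UNIV. E C i x * DG C A x) * E A d x
      + G A x * dE i A d x) * E A j x + G A x * E A d x * dE i A j x) x"
    by (rule has_partial_cong[THEN iffD2, OF open_U x metric_eq], assumption)
       (intro has_partial_sum has_partial_mult DG dE x)
  then have "partial i (\<lambda>y. g y $ d $ j) x = (\<Sum>A\<in>UNIV. ((\<Sum>C\<in>UNIV. E C i x * DG C A x) * E A d x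
      + G A x * dE i A d x) * E A j x + G A x * E A d x * dE i A j x)"
    by (rule partial_eqI)
  also have "\<dots> = (\<Sum>A\<in>UNIV. G A x * (E A d x * dE i A j x + E A j x * dE i A d x))
      + (\<Sum>A\<in>UNIV. (\<Sum>C\<in>UNIV. E C i x * DG C A x) * E A d x * E A j x)"
    by (simp add: algebra_simps sum.distrib)
  \<comment> \<open>The single sum over \<open>A\<close> is spread over pairs \<open>A\<close>,
    \<open>B\<close> with a Kronecker factor, which is the right side of
    \<open>compatible\<close>.\<close>
  also have "(\<Sum>A\<in>UNIV. (\<Sum>C\<in>UNIV. E C i x * DG C A x) * E A d x * E A j x)
      = (\<Sum>A\<in>UNIV. \<Sum>B\<in>UNIV. \<Sum>C\<in>UNIV. E C i x * E A d x * E B j x * (if A = B then DG C A x else 0))"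
  proof (rule sum.cong[OF refl])
    fix A
    have "(\<Sum>B\<in>UNIV. \<Sum>C\<in>UNIV. E C i x * E A d x * E B j x * (if A = B then DG C A x else 0))
        = (\<Sum>B\<in>UNIV. if A = B then \<Sum>C\<in>UNIV. E C i x * E A d x * E B j x * DG C A x else 0)"
      by (rule sum.cong) auto
    then show "(\<Sum>C\<in>UNIV. E C i x * DG C A x) * E A d x * E A j x
        = (\<Sum>B\<in>UNIV. \<Sum>C\<in>UNIV. E C i x * E A d x * E B j x * (if A = B then DG C A x else 0))"
      by (simp add: sum_distrib_left sum_distrib_right ac_simps)
  qed
  also have "\<dots> = (\<Sum>A\<in>UNIV. \<Sum>B\<in>UNIV. \<Sum>C\<in>UNIV. E C i x * E A d x * E B j x * (G A x * \<gamma> A B C x))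
      + (\<Sum>A\<in>UNIV. \<Sum>B\<in>UNIV. \<Sum>C\<in>UNIV. E C i x * E A d x * E B j x * (G B x * \<gamma> B A C x))"
    by (simp add: compatible[OF x, symmetric] distrib_left sum.distrib)
  also have "(\<Sum>A\<in>UNIV. \<Sum>B\<in>UNIV. \<Sum>C\<in>UNIV. E C i x * E A d x * E B j x * (G B x * \<gamma> B A C x))
      = (\<Sum>A\<in>UNIV. \<Sum>B\<in>UNIV. \<Sum>C\<in>UNIV. E C i x * E B d x * E A j x * (G A x * \<gamma> A B C x))"
    by (rule sum.swap)
  also have "(\<Sum>A\<in>UNIV. \<Sum>B\<in>UNIV. \<Sum>C\<in>UNIV. E C i x * E A d x * E B j x * (G A x * \<gamma> A B C x)) + \<dots>
      = (\<Sum>A\<in>UNIV. G A x * (E A d x * (H A i j x - dE i A j x) + E A j x * (H A i d x - dE i A d x)))"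
    unfolding H_diff
    by (simp add: sum_distrib_left distrib_left sum.distrib ac_simps)
  also have "(\<Sum>A\<in>UNIV. G A x * (E A d x * dE i A j x + E A j x * dE i A d x)) + \<dots>
      = (\<Sum>A\<in>UNIV. G A x * (E A d x * H A i j x + E A j x * H A i d x))"
    unfolding sum.distrib[symmetric] by (rule sum.cong) (simp_all add: algebra_simps)
  finally show ?thesis .
qed

text \<open>In the alternating sum of three derivatives of the metric, the symmetry of
  \<open>H\<close> cancels four of the six terms and makes the other two equal.\<close>

lemma christoffel_eq: "x \<in> U \<Longrightarrow> christoffel g k i j x = up x (\<lambda>A. H A i j x) k"
proof -
  assume x: "x \<in> U"
  have "partial i (\<lambda>y. g y $ d $ j) x + partial j (\<lambda>y. g y $ d $ i) x - partial d (\<lambda>y. g y $ i $ j) x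
      = 2 * low x (\<lambda>A. G A x * H A i j x) d" for d
    unfolding partial_metric[OF x] low_def sum_distrib_left sum.distrib[symmetric] sum_subtractf[symmetric]
      H_commute[OF x, of _ d i] H_commute[OF x, of _ d j] H_commute[OF x, of _ j i]
    by (rule sum.cong) (simp_all add: algebra_simps)
  then have "christoffel g k i j x
      = (\<Sum>d\<in>UNIV. inv_metric g x $ k $ d * low x (\<lambda>A. G A x * H A i j x) d)"
    unfolding christoffel_def by (simp add: sum_distrib_left)
  then show ?thesis
    by (simp add: inv_metric_low[OF x] G_nonzero[OF x])
qed

section \<open>The Riemann tensor in the frame\<close>

lemma coframe_christoffel: "x \<in> U \<Longrightarrow> (\<Sum>k\<in>UNIV. E A k x * christoffel g k i j x) = H A i j x"
  by (simp add: christoffel_eq coframe_up)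

text \<open>The last summand is minus the covariant derivative along the commutator of
  \<open>e C\<close> and \<open>e D\<close>, which does not vanish in a non-coordinate frame;
  torsion-freeness expresses the commutator through \<open>\<gamma>\<close>.\<close>

definition frame_riemann :: "4 \<Rightarrow> 4 \<Rightarrow> 4 \<Rightarrow> 4 \<Rightarrow> point \<Rightarrow> real" where
  "frame_riemann A B C D x = D\<gamma> C A B D x - D\<gamma> D A B C x
    + (\<Sum>F\<in>UNIV. \<gamma> A F C x * \<gamma> F B D x - \<gamma> A F D x * \<gamma> F B C x
        + (\<gamma> F C D x - \<gamma> F D C x) * \<gamma> A B F x)"

definition dH :: "4 \<Rightarrow> 4 \<Rightarrow> 4 \<Rightarrow> 4 \<Rightarrow> point \<Rightarrow> real" where
  "dH k A i j x = ddE k i A j x + (\<Sum>C\<in>UNIV. \<Sum>B\<in>UNIV.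
      (dE k C i x * E B j x + E C i x * dE k B j x) * \<gamma> A B C x
      + E C i x * E B j x * (\<Sum>D\<in>UNIV. E D k x * D\<gamma> D A B C x))"

lemma has_partial_H: "x \<in> U \<Longrightarrow> has_partial (H A i j) k (dH k A i j x) x"
  unfolding H_def[abs_def] dH_def
  by (intro has_partial_add has_partial_sum has_partial_mult ddE dE D\<gamma>)

text \<open>Differentiating the contracted identity for \<open>H\<close>, rather than the formula
  for the Christoffel symbols, keeps derivatives of the frame vectors out of the result. This is why
  \<open>de\<close> asks only for their existence.\<close>

lemma coframe_partial_christoffel:
  assumes x: "x \<in> U"
  shows "(\<Sum>k\<in>UNIV. E A k x * partial c (christoffel g k d b) x)
    = dH c A d b x - (\<Sum>k\<in>UNIV. dE c A k x * christoffel g k d b x)"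
proof -
  have "\<exists>\<Gamma>'. has_partial (christoffel g k d b) c \<Gamma>' x" for k
  proof -
    have "\<forall>B. \<exists>d. has_partial (e B k) c d x"
      using de[OF x] by blast
    then obtain e' where "\<forall>B. has_partial (e B k) c (e' B) x"
      unfolding choice_iff by blast
    then have "has_partial (\<lambda>y. up y (\<lambda>A. H A d b y) k) c
        (\<Sum>B\<in>UNIV. e' B * H B d b x + e B k x * dH c B d b x) x"
      unfolding up_def by (intro has_partial_sum has_partial_mult has_partial_H x) simp
    moreover have "has_partial (christoffel g k d b) c \<Gamma>' x
        \<longleftrightarrow> has_partial (\<lambda>y. up y (\<lambda>A. H A d b y) k) c \<Gamma>' x" for \<Gamma>'
      by (rule has_partial_cong[OF open_U x]) (rule christoffel_eq)
    ultimately show ?thesis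
      by blast
  qed
  then have d\<Gamma>: "has_partial (christoffel g k d b) c (partial c (christoffel g k d b) x) x" for k
    using partial_eqI by blast
  have "has_partial (H A d b) c
      (\<Sum>k\<in>UNIV. dE c A k x * christoffel g k d b x + E A k x * partial c (christoffel g k d b) x) x"
    by (rule has_partial_cong[THEN iffD1, OF open_U x coframe_christoffel], assumption)
       (intro has_partial_sum has_partial_mult dE d\<Gamma> x)
  then show ?thesis
    using partial_eqI[OF has_partial_H[OF x]] partial_eqI by (fastforce simp: sum.distrib)
qed

text \<open>The second derivatives of the coframe cancel by \<open>ddE_commute\<close>. Of the first
  derivatives only the antisymmetrised ones survive, and \<open>torsion_free\<close> turns them into
  the commutator term.\<close>

lemma frame_riemann_expand:
  assumes x: "x \<in> U"
  shows "dH c A d b x - dH d A c b x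
      + (\<Sum>C\<in>UNIV. \<Sum>F\<in>UNIV. E C c x * \<gamma> A F C x * H F d b x)
      - (\<Sum>C\<in>UNIV. \<Sum>F\<in>UNIV. E C d x * \<gamma> A F C x * H F c b x)
    = low x (\<lambda>C. low x (\<lambda>D. low x (\<lambda>B. frame_riemann A B C D x) b) d) c"
proof -
  have dH': "dH c A d b x = ddE c d A b x
      + (\<Sum>F\<in>UNIV. \<Sum>B\<in>UNIV. dE c F d x * E B b x * \<gamma> A B F x)
      + (\<Sum>C\<in>UNIV. \<Sum>B\<in>UNIV. E C d x * dE c B b x * \<gamma> A B C x)
      + (\<Sum>D\<in>UNIV. \<Sum>B\<in>UNIV. \<Sum>C\<in>UNIV. E C c x * E D d x * E B b x * D\<gamma> C A B D x)" for c d
    unfolding dH_def by (simp add: algebra_simps sum.distrib sum_distrib_left)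
  have HH: "(\<Sum>C\<in>UNIV. \<Sum>F\<in>UNIV. E C c x * \<gamma> A F C x * H F d b x)
      = (\<Sum>C\<in>UNIV. \<Sum>F\<in>UNIV. E C c x * dE d F b x * \<gamma> A F C x)
      + (\<Sum>C\<in>UNIV. \<Sum>F\<in>UNIV. \<Sum>D\<in>UNIV. \<Sum>B\<in>UNIV. E C c x * E D d x * E B b x * (\<gamma> A F C x * \<gamma> F B D x))" for c d
    unfolding H_def by (simp add: algebra_simps sum.distrib sum_distrib_left)
  have dE': "(\<Sum>F\<in>UNIV. \<Sum>B\<in>UNIV. dE c F d x * E B b x * \<gamma> A B F x)
      - (\<Sum>F\<in>UNIV. \<Sum>B\<in>UNIV. dE d F c x * E B b x * \<gamma> A B F x)
      = (\<Sum>F\<in>UNIV. \<Sum>B\<in>UNIV. \<Sum>C\<in>UNIV. \<Sum>D\<in>UNIV.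
          E C c x * E D d x * E B b x * ((\<gamma> F C D x - \<gamma> F D C x) * \<gamma> A B F x))"
    unfolding sum_subtractf[symmetric] left_diff_distrib[symmetric] torsion_free[OF x]
      sum_distrib_left sum_distrib_right by (simp add: ac_simps)
  \<comment> \<open>The next five facts bring every sum that occurs into the order \<open>C\<close>,
    \<open>D\<close>, \<open>B\<close>, \<open>F\<close>.\<close>
  have r1: "(\<Sum>D\<in>UNIV. \<Sum>B\<in>UNIV. \<Sum>C\<in>UNIV. f B C D) = (\<Sum>C\<in>UNIV. \<Sum>D\<in>UNIV. \<Sum>B\<in>UNIV. f B C D)"
    for f :: "4 \<Rightarrow> 4 \<Rightarrow> 4 \<Rightarrow> real"
    by (rule trans[OF sum.cong[OF refl sum.swap] sum.swap])
  have r2: "(\<Sum>C\<in>UNIV. \<Sum>B\<in>UNIV. \<Sum>D\<in>UNIV. f B C D) = (\<Sum>C\<in>UNIV. \<Sum>D\<in>UNIV. \<Sum>B\<in>UNIV. f B C D)"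
    for f :: "4 \<Rightarrow> 4 \<Rightarrow> 4 \<Rightarrow> real"
    by (rule sum.cong[OF refl]) (rule sum.swap)
  have r3: "(\<Sum>C\<in>UNIV. \<Sum>F\<in>UNIV. \<Sum>D\<in>UNIV. \<Sum>B\<in>UNIV. f B C D F)
      = (\<Sum>C\<in>UNIV. \<Sum>D\<in>UNIV. \<Sum>B\<in>UNIV. \<Sum>F\<in>UNIV. f B C D F)"
    for f :: "4 \<Rightarrow> 4 \<Rightarrow> 4 \<Rightarrow> 4 \<Rightarrow> real"
    by (rule sum.cong[OF refl], subst sum.swap, rule sum.cong[OF refl], rule sum.swap)
  have r4: "(\<Sum>D\<in>UNIV. \<Sum>F\<in>UNIV. \<Sum>C\<in>UNIV. \<Sum>B\<in>UNIV. f B C D F)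
      = (\<Sum>C\<in>UNIV. \<Sum>D\<in>UNIV. \<Sum>B\<in>UNIV. \<Sum>F\<in>UNIV. f B C D F)"
    for f :: "4 \<Rightarrow> 4 \<Rightarrow> 4 \<Rightarrow> 4 \<Rightarrow> real"
    by (rule trans[OF r3 sum.swap])
  have r5: "(\<Sum>F\<in>UNIV. \<Sum>B\<in>UNIV. \<Sum>C\<in>UNIV. \<Sum>D\<in>UNIV. f B C D F)
      = (\<Sum>C\<in>UNIV. \<Sum>D\<in>UNIV. \<Sum>B\<in>UNIV. \<Sum>F\<in>UNIV. f B C D F)"
    for f :: "4 \<Rightarrow> 4 \<Rightarrow> 4 \<Rightarrow> 4 \<Rightarrow> real"
    by (rule trans[OF sum.cong[OF refl trans[OF sum.swap sum.cong[OF refl sum.swap]]]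
          trans[OF sum.swap r3]])
  have low3: "low x (\<lambda>C. low x (\<lambda>D. low x (\<lambda>B. f B C D) b) d) c
      = (\<Sum>C\<in>UNIV. \<Sum>D\<in>UNIV. \<Sum>B\<in>UNIV. E C c x * E D d x * E B b x * f B C D)" for f
    unfolding low_def sum_distrib_left by (simp add: ac_simps)
  let ?S = "\<lambda>f. \<Sum>C\<in>UNIV. \<Sum>D\<in>UNIV. \<Sum>B\<in>UNIV. E C c x * E D d x * E B b x * f B C D"
  have S: "?S f + ?S h = ?S (\<lambda>B C D. f B C D + h B C D)"
    "?S f - ?S h = ?S (\<lambda>B C D. f B C D - h B C D)" for f h
    by (simp_all add: distrib_left right_diff_distrib sum.distrib sum_subtractf)
  have t1: "(\<Sum>D\<in>UNIV. \<Sum>B\<in>UNIV. \<Sum>C\<in>UNIV. E C c x * E D d x * E B b x * D\<gamma> C A B D x) = ?S (\<lambda>B C D. D\<gamma> C A B D x)"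
    by (rule r1)
  have t2: "(\<Sum>C\<in>UNIV. \<Sum>B\<in>UNIV. \<Sum>D\<in>UNIV. E D d x * E C c x * E B b x * D\<gamma> D A B C x) = ?S (\<lambda>B C D. D\<gamma> D A B C x)"
    by (rule trans[OF r2]) (simp add: ac_simps)
  have t3: "(\<Sum>C\<in>UNIV. \<Sum>F\<in>UNIV. \<Sum>D\<in>UNIV. \<Sum>B\<in>UNIV. E C c x * E D d x * E B b x * (\<gamma> A F C x * \<gamma> F B D x))
      = ?S (\<lambda>B C D. \<Sum>F\<in>UNIV. \<gamma> A F C x * \<gamma> F B D x)"
    unfolding sum_distrib_left by (rule r3)
  have t4: "(\<Sum>D\<in>UNIV. \<Sum>F\<in>UNIV. \<Sum>C\<in>UNIV. \<Sum>B\<in>UNIV. E D d x * E C c x * E B b x * (\<gamma> A F D x * \<gamma> F B C x))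
      = ?S (\<lambda>B C D. \<Sum>F\<in>UNIV. \<gamma> A F D x * \<gamma> F B C x)"
    unfolding sum_distrib_left by (rule trans[OF r4]) (simp add: ac_simps)
  have t5: "(\<Sum>F\<in>UNIV. \<Sum>B\<in>UNIV. \<Sum>C\<in>UNIV. \<Sum>D\<in>UNIV. E C c x * E D d x * E B b x * ((\<gamma> F C D x - \<gamma> F D C x) * \<gamma> A B F x))
      = ?S (\<lambda>B C D. \<Sum>F\<in>UNIV. (\<gamma> F C D x - \<gamma> F D C x) * \<gamma> A B F x)"
    unfolding sum_distrib_left by (rule r5)
  have R: "frame_riemann A B C D x = D\<gamma> C A B D x - D\<gamma> D A B C x
      + (\<Sum>F\<in>UNIV. \<gamma> A F C x * \<gamma> F B D x) - (\<Sum>F\<in>UNIV. \<gamma> A F D x * \<gamma> F B C x)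
      + (\<Sum>F\<in>UNIV. (\<gamma> F C D x - \<gamma> F D C x) * \<gamma> A B F x)" for B C D
    unfolding frame_riemann_def by (simp add: sum.distrib sum_subtractf)
  show ?thesis
    unfolding low3 R S[symmetric]
    unfolding t1[symmetric] t2[symmetric] t3[symmetric] t4[symmetric] t5[symmetric] dE'[symmetric]
    unfolding dH' HH ddE_commute[OF x, of d c] by simp
qed

lemma riemann_up_eq:
  assumes x: "x \<in> U"
  shows "riemann_up g a b c d x
    = low x (\<lambda>C. low x (\<lambda>D. up x (\<lambda>A. low x (\<lambda>B. frame_riemann A B C D x) b) a) d) c"
proof -
  \<comment> \<open>The part with \<open>dE\<close> in this product is exactly the correction
    subtracted in \<open>coframe_partial_christoffel\<close>, so the two cancel.\<close>
  have quad: "(\<Sum>k\<in>UNIV. E A k x * (\<Sum>f\<in>UNIV. christoffel g k c f x * christoffel g f d b x))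
      = (\<Sum>f\<in>UNIV. dE c A f x * christoffel g f d b x)
      + (\<Sum>C\<in>UNIV. \<Sum>F\<in>UNIV. E C c x * \<gamma> A F C x * H F d b x)" for A c d
  proof -
    have "(\<Sum>k\<in>UNIV. E A k x * (\<Sum>f\<in>UNIV. christoffel g k c f x * christoffel g f d b x))
        = (\<Sum>f\<in>UNIV. (\<Sum>k\<in>UNIV. E A k x * christoffel g k c f x) * christoffel g f d b x)"
      unfolding sum_distrib_left sum_distrib_right by (subst sum.swap) (simp add: ac_simps)
    also have "\<dots> = (\<Sum>f\<in>UNIV. dE c A f x * christoffel g f d b x)
        + (\<Sum>f\<in>UNIV. \<Sum>C\<in>UNIV. \<Sum>F\<in>UNIV. E C c x * \<gamma> A F C x * (E F f x * christoffel g f d b x))"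
      unfolding coframe_christoffel[OF x] H_def
      by (simp add: distrib_left distrib_right sum.distrib sum_distrib_left sum_distrib_right ac_simps)
    also have "(\<Sum>f\<in>UNIV. \<Sum>C\<in>UNIV. \<Sum>F\<in>UNIV. E C c x * \<gamma> A F C x * (E F f x * christoffel g f d b x))
        = (\<Sum>C\<in>UNIV. \<Sum>F\<in>UNIV. \<Sum>f\<in>UNIV. E C c x * \<gamma> A F C x * (E F f x * christoffel g f d b x))"
      by (subst sum.swap, rule sum.cong[OF refl], rule sum.swap)
    finally show ?thesis
      by (simp add: coframe_christoffel[OF x] flip: sum_distrib_left)
  qed
  have "(\<Sum>k\<in>UNIV. E A k x * riemann_up g k b c d x)
      = low x (\<lambda>C. low x (\<lambda>D. low x (\<lambda>B. frame_riemann A B C D x) b) d) c" for A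
  proof -
    have "(\<Sum>k\<in>UNIV. E A k x * riemann_up g k b c d x)
        = (\<Sum>k\<in>UNIV. E A k x * partial c (christoffel g k d b) x)
        - (\<Sum>k\<in>UNIV. E A k x * partial d (christoffel g k c b) x)
        + (\<Sum>k\<in>UNIV. E A k x * (\<Sum>f\<in>UNIV. christoffel g k c f x * christoffel g f d b x))
        - (\<Sum>k\<in>UNIV. E A k x * (\<Sum>f\<in>UNIV. christoffel g k d f x * christoffel g f c b x))"
      unfolding riemann_up_def by (simp add: algebra_simps sum.distrib sum_subtractf)
    then show ?thesis
      unfolding quad coframe_partial_christoffel[OF x] frame_riemann_expand[OF x, symmetric] by simp
  qed
  then have "riemann_up g a b c d x
      = up x (\<lambda>A. low x (\<lambda>C. low x (\<lambda>D. low x (\<lambda>B. frame_riemann A B C D x) b) d) c) a"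
    using up_coframe[OF x, of "\<lambda>k. riemann_up g k b c d x" a] by simp
  then show ?thesis
    by (simp add: up_low_swap)
qed

end

lemma sum_swap_pairs:
  "(\<Sum>c\<in>A. \<Sum>d\<in>B. \<Sum>k\<in>C. \<Sum>l\<in>D. f c d k l) = (\<Sum>k\<in>C. \<Sum>l\<in>D. \<Sum>c\<in>A. \<Sum>d\<in>B. f c d k l)"
  by (rule trans[OF sum.cong[OF refl trans[OF sum.swap sum.cong[OF refl sum.swap]]]
        trans[OF sum.swap sum.cong[OF refl sum.swap]]])

context orthogonal_frame begin

section \<open>Weyl tensor and scalar invariants in the frame\<close>

lemma low_times: "low x f a * c = low x (\<lambda>A. f A * c) a"
  unfolding low_def sum_distrib_right by (simp add: ac_simps)

lemma low_divide: "low x f a / c = low x (\<lambda>A. f A / c) a"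
  unfolding low_def sum_divide_distrib by simp

lemma up_divide: "up x f a / c = up x (\<lambda>A. f A / c) a"
  unfolding up_def sum_divide_distrib by simp

lemma sum_mult_low: "(\<Sum>k\<in>K. h k * low x (f k) a) = low x (\<lambda>A. \<Sum>k\<in>K. h k * f k A) a"
  unfolding mult_low sum_low by (rule refl)

definition frame_ricci :: "4 \<Rightarrow> 4 \<Rightarrow> point \<Rightarrow> real" where
  "frame_ricci B D x = (\<Sum>A\<in>UNIV. frame_riemann A B A D x)"

definition frame_scalar :: "point \<Rightarrow> real" where
  "frame_scalar x = (\<Sum>B\<in>UNIV. frame_ricci B B x / G B x)"

definition frame_metric :: "4 \<Rightarrow> 4 \<Rightarrow> point \<Rightarrow> real" where
  "frame_metric A B x = (if A = B then G A x else 0)"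

definition frame_weyl :: "4 \<Rightarrow> 4 \<Rightarrow> 4 \<Rightarrow> 4 \<Rightarrow> point \<Rightarrow> real" where
  "frame_weyl A B C D x = G A x * frame_riemann A B C D x
    - (1/2) * (frame_metric A C x * frame_ricci B D x - frame_metric A D x * frame_ricci B C x
               - frame_metric B C x * frame_ricci A D x + frame_metric B D x * frame_ricci A C x)
    + (1/6) * frame_scalar x *
      (frame_metric A C x * frame_metric B D x - frame_metric A D x * frame_metric B C x)"

lemma metric_low: "x \<in> U \<Longrightarrow> g x $ i $ j = low x (\<lambda>A. low x (\<lambda>B. frame_metric A B x) j) i"
  unfolding low_def frame_metric_def
  by (simp add: metric_eq if_distrib[of "\<lambda>c. _ * c"] ac_simps cong: if_cong)

lemma riemann_eq:
  assumes x: "x \<in> U"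
  shows "riemann g a b c d x
    = low x (\<lambda>C. low x (\<lambda>D. low x (\<lambda>A. low x (\<lambda>B. G A x * frame_riemann A B C D x) b) a) d) c"
  unfolding riemann_def riemann_up_eq[OF x] mult_low sum_low metric_up[OF x] by (rule refl)

lemma ricci_eq:
  assumes x: "x \<in> U"
  shows "ricci g b d x = low x (\<lambda>D. low x (\<lambda>B. frame_ricci B D x) b) d"
proof -
  have "ricci g b d x = (\<Sum>k\<in>UNIV. low x (\<lambda>D. low x (\<lambda>C. up x (\<lambda>A.
      low x (\<lambda>B. frame_riemann A B C D x) b) k) k) d)"
    unfolding ricci_def riemann_up_eq[OF x] by (simp add: low_swap[of x _ d])
  then show ?thesis
    unfolding sum_low trace_low_up[OF x] frame_ricci_def by simp
qed

lemma scalar_curvature_eq: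
  assumes x: "x \<in> U"
  shows "scalar_curvature g x = frame_scalar x"
proof -
  have "scalar_curvature g x = (\<Sum>k\<in>UNIV. low x (\<lambda>B. up x (\<lambda>D. frame_ricci B D x / G D x) k) k)"
    unfolding scalar_curvature_def ricci_eq[OF x] inv_metric_low[OF x]
    unfolding low_divide up_low_swap by (rule refl)
  then show ?thesis
    unfolding trace_low_up[OF x, of "\<lambda>D B. frame_ricci B D x / G D x"] frame_scalar_def .
qed

lemma low_product:
  "low x (\<lambda>C. low x (\<lambda>A. M A C) a) c * low x (\<lambda>D. low x (\<lambda>B. N B D) b) d
    = low x (\<lambda>C. low x (\<lambda>D. low x (\<lambda>A. low x (\<lambda>B. M A C * N B D) b) a) d) c"
  unfolding low_times
  unfolding mult_low
  by (simp add: low_swap[of x _ d a])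

lemma weyl_eq:
  assumes x: "x \<in> U"
  shows "weyl g a b c d x
    = low x (\<lambda>C. low x (\<lambda>D. low x (\<lambda>A. low x (\<lambda>B. frame_weyl A B C D x) b) a) d) c"
proof -
  let ?L = "\<lambda>f. low x (\<lambda>C. low x (\<lambda>D. low x (\<lambda>A. low x (\<lambda>B. f A B C D) b) a) d) c"
  have g: "g x $ i $ j = low x (\<lambda>B. low x (\<lambda>A. frame_metric A B x) i) j" for i j
    by (subst low_swap) (rule metric_low[OF x])
  \<comment> \<open>Every trace term is brought to the nesting \<open>C\<close>, \<open>D\<close>,
    \<open>A\<close>, \<open>B\<close> of the Riemann tensor, so that the sum can be taken
    componentwise inside.\<close>
  have ac: "g x $ a $ c * low x (\<lambda>D. low x (\<lambda>B. N B D) b) d = ?L (\<lambda>A B C D. frame_metric A C x * N B D)" for N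
    unfolding g by (rule low_product)
  have ad: "g x $ a $ d * low x (\<lambda>D. low x (\<lambda>B. N B D) b) c = ?L (\<lambda>A B C D. frame_metric A D x * N B C)" for N
    unfolding g low_product by (rule low_swap)
  have bc: "g x $ b $ c * low x (\<lambda>D. low x (\<lambda>B. N B D) a) d = ?L (\<lambda>A B C D. frame_metric B C x * N A D)" for N
    unfolding g low_product by (simp add: low_swap[of x _ a b])
  have bd: "g x $ b $ d * low x (\<lambda>D. low x (\<lambda>B. N B D) a) c = ?L (\<lambda>A B C D. frame_metric B D x * N A C)" for N
    unfolding g low_product by (subst low_swap) (simp add: low_swap[of x _ a b])
  have gg: "g x $ a $ c * g x $ b $ d = ?L (\<lambda>A B C D. frame_metric A C x * frame_metric B D x)"
    "g x $ a $ d * g x $ b $ c = ?L (\<lambda>A B C D. frame_metric A D x * frame_metric B C x)"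
    unfolding g[of b d] g[of b c] ac ad by (rule refl)+
  show ?thesis
    unfolding weyl_def riemann_eq[OF x] ricci_eq[OF x] scalar_curvature_eq[OF x] ac ad bc bd gg
    unfolding low_add low_diff mult_low frame_weyl_def by (rule refl)
qed

lemma weyl_up2_eq:
  assumes x: "x \<in> U"
  shows "weyl_up2 g k l c d x = low x (\<lambda>C. low x (\<lambda>D. up x (\<lambda>A. up x (\<lambda>B.
    frame_weyl A B C D x / (G A x * G B x)) l) k) d) c"
proof -
  have "weyl_up2 g k l c d x
      = (\<Sum>a\<in>UNIV. inv_metric g x $ k $ a * (\<Sum>b\<in>UNIV. inv_metric g x $ l $ b * weyl g a b c d x))"
    unfolding weyl_up2_def by (simp add: sum_distrib_left mult.assoc)
  also have "\<dots> = low x (\<lambda>C. low x (\<lambda>D. up x (\<lambda>A. up x (\<lambda>B.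
      frame_weyl A B C D x / G B x) l / G A x) k) d) c"
    unfolding weyl_eq[OF x] sum_mult_low inv_metric_low[OF x] by (rule refl)
  finally show ?thesis
    unfolding up_divide divide_divide_eq_left mult.commute[of "G _ x" "G _ x"]
    by (simp add: mult.commute)
qed

lemma weyl_up4_eq:
  assumes x: "x \<in> U"
  shows "weyl_up4 g k l m n x = up x (\<lambda>C. up x (\<lambda>D. up x (\<lambda>A. up x (\<lambda>B.
    frame_weyl A B C D x / (G A x * G B x * G C x * G D x)) l) k) n) m"
proof -
  have "weyl_up4 g k l m n x
      = (\<Sum>c\<in>UNIV. inv_metric g x $ m $ c * (\<Sum>d\<in>UNIV. inv_metric g x $ n $ d * weyl_up2 g k l c d x))"
    unfolding weyl_up4_def by (simp add: sum_distrib_left mult.assoc)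
  also have "\<dots> = up x (\<lambda>C. up x (\<lambda>D. up x (\<lambda>A. up x (\<lambda>B.
      frame_weyl A B C D x / (G A x * G B x)) l) k / G D x) n / G C x) m"
    unfolding weyl_up2_eq[OF x] sum_mult_low inv_metric_low[OF x] by (rule refl)
  finally show ?thesis
    unfolding up_divide by (simp add: ac_simps)
qed

lemma low_up_pairing2:
  assumes x: "x \<in> U"
  shows "(\<Sum>c\<in>UNIV. \<Sum>d\<in>UNIV. low x (\<lambda>C. low x (P C) d) c * up x (\<lambda>C. up x (Q C) d) c)
    = (\<Sum>C\<in>UNIV. \<Sum>D\<in>UNIV. P C D * Q C D)"
proof -
  have "(\<Sum>c\<in>UNIV. \<Sum>d\<in>UNIV. low x (\<lambda>C. low x (P C) d) c * up x (\<lambda>C. up x (Q C) d) c)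
      = (\<Sum>d\<in>UNIV. \<Sum>C\<in>UNIV. low x (P C) d * up x (Q C) d)"
    by (subst sum.swap) (simp add: low_up_pairing[OF x])
  also have "\<dots> = (\<Sum>C\<in>UNIV. \<Sum>D\<in>UNIV. P C D * Q C D)"
    by (subst sum.swap) (simp add: low_up_pairing[OF x])
  finally show ?thesis .
qed

text \<open>The indices \<open>c\<close>, \<open>d\<close> pair a lower with an upper position and
  pass to the frame unchanged; the other four are contracted with the coordinate symbol and cost the
  frame determinant.\<close>

lemma dual_weyl_weyl_eq:
  assumes x: "x \<in> U"
  shows "dual_weyl_weyl g x = sqrt \<bar>det (g x)\<bar> * det (\<chi> A k. e A k x) / 2 *
    (\<Sum>A\<in>UNIV. \<Sum>B\<in>UNIV. \<Sum>K\<in>UNIV. \<Sum>L\<in>UNIV. levi_civita_symbol A B K L *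
      (\<Sum>C\<in>UNIV. \<Sum>D\<in>UNIV. frame_weyl K L C D x / (G K x * G L x) *
        (frame_weyl A B C D x / (G A x * G B x * G C x * G D x))))"
proof -
  let ?t = "\<lambda>A B K L. \<Sum>C\<in>UNIV. \<Sum>D\<in>UNIV. frame_weyl K L C D x / (G K x * G L x) *
        (frame_weyl A B C D x / (G A x * G B x * G C x * G D x))"
  have up4: "up x (\<lambda>A. up x (\<lambda>B. p A B) l) k * up x (\<lambda>A. up x (\<lambda>B. q A B) b) a
      = (\<Sum>(A, B, K, L)\<in>UNIV. e A a x * e B b x * e K k x * e L l x * (p K L * q A B))"
    for p q :: "4 \<Rightarrow> 4 \<Rightarrow> real" and a b k l
  proof -
    have "up x (\<lambda>A. up x (\<lambda>B. p A B) l) k * up x (\<lambda>A. up x (\<lambda>B. q A B) b) a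
      = (\<Sum>A\<in>UNIV. \<Sum>B\<in>UNIV. e A a x * e B b x * q A B) * (\<Sum>K\<in>UNIV. \<Sum>L\<in>UNIV. e K k x * e L l x * p K L)"
      by (subst mult.commute) (simp add: up_def sum_distrib_left mult.assoc)
    also have "\<dots> = (\<Sum>A\<in>UNIV. \<Sum>B\<in>UNIV. \<Sum>K\<in>UNIV. \<Sum>L\<in>UNIV.
        e A a x * e B b x * e K k x * e L l x * (p K L * q A B))"
      unfolding sum_distrib_right unfolding sum_distrib_left by (simp add: ac_simps)
    finally show ?thesis
      by (simp add: sum.cartesian_product)
  qed
  have contract: "(\<Sum>c\<in>UNIV. \<Sum>d\<in>UNIV. weyl_up2 g k l c d x * weyl_up4 g a b c d x)
      = (\<Sum>A\<in>UNIV. \<Sum>B\<in>UNIV. \<Sum>K\<in>UNIV. \<Sum>L\<in>UNIV. e A a x * e B b x * e K k x * e L l x * ?t A B K L)"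
    for a b k l
  proof -
    have "(\<Sum>c\<in>UNIV. \<Sum>d\<in>UNIV. weyl_up2 g k l c d x * weyl_up4 g a b c d x)
        = (\<Sum>C\<in>UNIV. \<Sum>D\<in>UNIV. \<Sum>(A, B, K, L)\<in>UNIV. e A a x * e B b x * e K k x * e L l x *
            (frame_weyl K L C D x / (G K x * G L x) *
              (frame_weyl A B C D x / (G A x * G B x * G C x * G D x))))"
      unfolding weyl_up2_eq[OF x] weyl_up4_eq[OF x] low_up_pairing2[OF x] up4
      by (rule refl)
    also have "\<dots> = (\<Sum>(A, B, K, L)\<in>UNIV. e A a x * e B b x * e K k x * e L l x *
        (\<Sum>C\<in>UNIV. \<Sum>D\<in>UNIV. frame_weyl K L C D x / (G K x * G L x) *
              (frame_weyl A B C D x / (G A x * G B x * G C x * G D x))))"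
      unfolding case_prod_unfold sum_distrib_left
      by (rule trans[OF sum.cong[OF refl sum.swap] sum.swap])
    finally show ?thesis
      by (simp add: sum.cartesian_product)
  qed
  have "dual_weyl_weyl g x = (\<Sum>a\<in>UNIV. \<Sum>b\<in>UNIV. \<Sum>c\<in>UNIV. \<Sum>d\<in>UNIV. \<Sum>k\<in>UNIV. \<Sum>l\<in>UNIV.
      sqrt \<bar>det (g x)\<bar> / 2 * (levi_civita_symbol a b k l * (weyl_up2 g k l c d x * weyl_up4 g a b c d x)))"
    unfolding dual_weyl_weyl_def dual_weyl_def levi_civita_def sum_distrib_left sum_distrib_right
    by (simp add: ac_simps)
  also have "\<dots> = (\<Sum>a\<in>UNIV. \<Sum>b\<in>UNIV. \<Sum>k\<in>UNIV. \<Sum>l\<in>UNIV. \<Sum>c\<in>UNIV. \<Sum>d\<in>UNIV.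
      sqrt \<bar>det (g x)\<bar> / 2 * (levi_civita_symbol a b k l * (weyl_up2 g k l c d x * weyl_up4 g a b c d x)))"
    by (rule sum.cong[OF refl], rule sum.cong[OF refl], rule sum_swap_pairs)
  also have "\<dots> = sqrt \<bar>det (g x)\<bar> / 2 * (\<Sum>a\<in>UNIV. \<Sum>b\<in>UNIV. \<Sum>k\<in>UNIV. \<Sum>l\<in>UNIV. levi_civita_symbol a b k l *
      (\<Sum>c\<in>UNIV. \<Sum>d\<in>UNIV. weyl_up2 g k l c d x * weyl_up4 g a b c d x))"
    by (simp only: sum_distrib_left)
  finally show ?thesis
    unfolding contract sum_levi_civita_transform[of "\<lambda>A k. e A k x" ?t] by simp
qed


text \<open>The Gram matrix of the frame is diagonal, so \<open>det (g x)\<close> times the squared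
  frame determinant is the product of the norms. Only the orientation of the frame remains as a
  sign.\<close>

lemma sqrt_det_metric:
  assumes x: "x \<in> U"
  shows "sqrt \<bar>det (g x)\<bar> * det (\<chi> A k. e A k x) = sgn (det (\<chi> A k. e A k x)) * sqrt \<bar>\<Prod>A\<in>UNIV. G A x\<bar>"
proof -
  define M where "M = (\<chi> A k. e A k x)"
  have "(\<Sum>j\<in>UNIV. g x $ i $ j * e B j x) = E B i x * G B x" for i B
    using metric_up[OF x, of i "\<lambda>A. if A = B then 1 else 0"]
    by (simp add: up_def low_def if_distrib[of "\<lambda>c. _ * c"] cong: if_cong)
  then have "M ** (g x ** transpose M) = (\<chi> A B. if A = B then G A x else 0)"
    using dual[OF x]
    by (simp add: M_def matrix_matrix_mult_def transpose_def vec_eq_iff mult.assoc[symmetric]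
        sum_distrib_right[symmetric]) (simp add: mult.commute)
  then have "det M * (det (g x) * det M) = det (\<chi> A B. if A = B then G A x else 0)"
    by (metis det_mul det_transpose)
  also have "\<dots> = (\<Prod>A\<in>UNIV. G A x)"
    by (subst det_diagonal) simp_all
  finally have "(\<Prod>A\<in>UNIV. G A x) = det (g x) * (det M)\<^sup>2"
    by (simp add: power2_eq_square mult.left_commute)
  then have "sqrt \<bar>\<Prod>A\<in>UNIV. G A x\<bar> = sqrt \<bar>det (g x)\<bar> * \<bar>det M\<bar>"
    by (simp add: abs_mult real_sqrt_mult)
  then show ?thesis
    by (simp add: M_def sgn_mult_abs mult.left_commute)
qed

text \<open>The inverse metric is diagonal in the frame, so only squares of derivatives along frame
  vectors occur, and the sign in \<open>l_covector\<close> drops out.\<close>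

lemma I6_eq:
  assumes x: "x \<in> U"
  shows "I6 g x = (\<Sum>A\<in>UNIV. (\<Sum>i\<in>UNIV. e A i x * partial i (dual_weyl_weyl g) x)\<^sup>2 / G A x)"
proof -
  let ?k = "\<lambda>i. partial i (dual_weyl_weyl g) x"
  have "I6 g x = (\<Sum>i\<in>UNIV. \<Sum>j\<in>UNIV. \<Sum>A\<in>UNIV. e A i x * ?k i * (e A j x * ?k j) / G A x)"
    unfolding I6_def l_covector_def inv_metric_eq[OF x] sum_distrib_right by (simp add: ac_simps)
  also have "\<dots> = (\<Sum>A\<in>UNIV. \<Sum>i\<in>UNIV. \<Sum>j\<in>UNIV. e A i x * ?k i * (e A j x * ?k j) / G A x)"
    by (rule trans[OF sum.cong[OF refl sum.swap] sum.swap])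
  finally show ?thesis
    by (simp add: power2_eq_square sum_product sum_divide_distrib)
qed

end

section \<open>The Carter family of metrics\<close>

text \<open>Components are stored as literal nested tables: \<open>forall_4\<close> splits a claim
  about all indices into cases, and \<open>tab_simps\<close> turns each case into a scalar
  identity.\<close>

definition tab :: "'a \<Rightarrow> 'a \<Rightarrow> 'a \<Rightarrow> 'a \<Rightarrow> 4 \<Rightarrow> 'a" where
  "tab p q r s i = (if i = 1 then p else if i = 2 then q else if i = 3 then r else s)"

lemma tab_simps [simp]: "tab p q r s 1 = p" "tab p q r s 2 = q" "tab p q r s 3 = r" "tab p q r s 4 = s"
  by (simp_all add: tab_def)

lemma has_partial_r_theta:
  fixes F :: "real \<Rightarrow> real \<Rightarrow> real"
  assumes "((\<lambda>r. F r (x $ 3)) has_real_derivative Fr) (at (x $ 2))"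
    and "(F (x $ 2) has_real_derivative F\<theta>) (at (x $ 3))"
  shows "has_partial (\<lambda>y. F (y $ 2) (y $ 3)) i (tab 0 Fr F\<theta> 0 i) x"
proof -
  have shift: "((\<lambda>h. f (z + h)) has_real_derivative d) (at 0)"
    if "(f has_real_derivative d) (at z)" for f :: "real \<Rightarrow> real" and d z
    using DERIV_shift[of f d 0 z] that by (simp add: add.commute)
  have "i = 1 \<or> i = 2 \<or> i = 3 \<or> i = 4"
    by (rule exhaust_4)
  then show ?thesis
    unfolding has_partial_def
    by (elim disjE) (simp_all add: axis_def shift[OF assms(1)] shift[OF assms(2)])
qed

lemma has_partial_r_cos:
  fixes F :: "real \<Rightarrow> real \<Rightarrow> real"
  assumes "((\<lambda>r. F r (cos (x $ 3))) has_real_derivative Fr) (at (x $ 2))"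
    and "(F (x $ 2) has_real_derivative Fc) (at (cos (x $ 3)))"
  shows "has_partial (\<lambda>y. F (y $ 2) (cos (y $ 3))) i (tab 0 Fr (- sin (x $ 3) * Fc) 0 i) x"
  using has_partial_r_theta[of "\<lambda>r \<theta>. F r (cos \<theta>)", OF assms(1)]
    DERIV_chain2[OF assms(2) DERIV_cos] by (simp add: mult.commute)

text \<open>\<open>R\<close> and \<open>Q\<close> are free functions of one variable with named
  derivatives, so that they can serve as atoms; \<open>\<xi>\<close> will be the reciprocal of
  \<open>Xi\<close>.\<close>

locale carter_functions =
  fixes a \<xi> :: real and R R' R'' Q Q' Q'' :: "real \<Rightarrow> real"
  assumes \<xi>_nonzero: "\<xi> \<noteq> 0"
    and R': "(R has_real_derivative R' r) (at r)"
    and R'': "(R' has_real_derivative R'' r) (at r)"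
    and Q': "(Q has_real_derivative Q' r) (at r)"
    and Q'': "(Q' has_real_derivative Q'' r) (at r)"
begin

definition u :: "real \<Rightarrow> real \<Rightarrow> real" where
  "u r c = r^2 + a^2 * c^2"

definition chart :: "point set" where
  "chart = {x. 0 < x $ 3 \<and> x $ 3 < pi \<and> u (x $ 2) (cos (x $ 3)) \<noteq> 0 \<and> R (x $ 2) \<noteq> 0 \<and> Q (cos (x $ 3)) \<noteq> 0}"

definition coframe :: "4 \<Rightarrow> 4 \<Rightarrow> point \<Rightarrow> real" where
  "coframe A i x = tab
    (tab \<xi> 0 0 (- \<xi> * a * (sin (x $ 3))^2) i)
    (tab 0 1 0 0 i)
    (tab 0 0 (- sin (x $ 3)) 0 i)
    (tab (\<xi> * a) 0 0 (- \<xi> * ((x $ 2)^2 + a^2)) i) A"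

definition frame :: "4 \<Rightarrow> 4 \<Rightarrow> point \<Rightarrow> real" where
  "frame A i x = tab
    (tab (((x $ 2)^2 + a^2) / (\<xi> * u (x $ 2) (cos (x $ 3)))) 0 0 (a / (\<xi> * u (x $ 2) (cos (x $ 3)))) i)
    (tab 0 1 0 0 i)
    (tab 0 0 (- 1 / sin (x $ 3)) 0 i)
    (tab (- a * (sin (x $ 3))^2 / (\<xi> * u (x $ 2) (cos (x $ 3)))) 0 0 (- 1 / (\<xi> * u (x $ 2) (cos (x $ 3)))) i) A"

definition d_coframe :: "4 \<Rightarrow> 4 \<Rightarrow> 4 \<Rightarrow> point \<Rightarrow> real" where
  "d_coframe k A i x = tab 0
    (tab 0 0 0 (tab 0 0 0 (- 2 * \<xi> * x $ 2) i) A)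
    (tab (tab 0 0 0 (- 2 * \<xi> * a * sin (x $ 3) * cos (x $ 3)) i) 0 (tab 0 0 (- cos (x $ 3)) 0 i) 0 A)
    0 k"

definition dd_coframe :: "4 \<Rightarrow> 4 \<Rightarrow> 4 \<Rightarrow> 4 \<Rightarrow> point \<Rightarrow> real" where
  "dd_coframe l k A i x = tab 0
    (tab 0 (tab 0 0 0 (tab 0 0 0 (- 2 * \<xi>) i) A) 0 0 k)
    (tab 0 0 (tab (tab 0 0 0 (2 * \<xi> * a * ((sin (x $ 3))^2 - (cos (x $ 3))^2)) i) 0 (tab 0 0 (sin (x $ 3)) 0 i) 0 A) 0 k)
    0 l"

definition norm2 :: "4 \<Rightarrow> real \<Rightarrow> real \<Rightarrow> real" where
  "norm2 A r c = tab (- R r / u r c) (u r c / R r) (u r c / Q c) (Q c / u r c) A"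

definition norm2_r :: "4 \<Rightarrow> real \<Rightarrow> real \<Rightarrow> real" where
  "norm2_r A r c = tab (2 * r * R r / (u r c)^2 - R' r / u r c) (2 * r / R r - u r c * R' r / (R r)^2)
    (2 * r / Q c) (- 2 * r * Q c / (u r c)^2) A"

definition norm2_c :: "4 \<Rightarrow> real \<Rightarrow> real \<Rightarrow> real" where
  "norm2_c A r c = tab (2 * a^2 * c * R r / (u r c)^2) (2 * a^2 * c / R r)
    (2 * a^2 * c / Q c - u r c * Q' c / (Q c)^2) (Q' c / u r c - 2 * a^2 * c * Q c / (u r c)^2) A"

text \<open>These are the Levi-Civita coefficients of the frame, justified afterwards by
  \<open>coframe_torsion_free\<close> and \<open>conn_compatible\<close>. The outermost table is
  indexed by the direction \<open>K\<close>, the next by \<open>A\<close>, the innermost by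
  \<open>B\<close>. \<open>\<xi>\<close> is absent because it only rescales the coordinates t and
  \<phi>.\<close>

definition conn :: "4 \<Rightarrow> 4 \<Rightarrow> 4 \<Rightarrow> real \<Rightarrow> real \<Rightarrow> real" where
  "conn A B K r c = tab
    (tab
      (tab 0 (R' r / (2 * R r) - r / u r c) (a^2 * c / u r c) 0 B)
      (tab (R r * R' r / (2 * (u r c)^2) - r * (R r)^2 / (u r c)^3) 0 0 (a * r * R r * Q c / (u r c)^3) B)
      (tab (a^2 * c * R r * Q c / (u r c)^3) 0 0 (- (a * c * R r * Q c / (u r c)^3)) B)
      (tab 0 (- (a * r / u r c)) (a * c * R r / (u r c * Q c)) 0 B) A)
    (tab
      (tab (R' r / (2 * R r) - r / u r c) 0 0 (a * r * Q c / (u r c * R r)) B)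
      (tab 0 (r / u r c - R' r / (2 * R r)) (a^2 * c / u r c) 0 B)
      (tab 0 (- (a^2 * c * Q c / (u r c * R r))) (r / u r c) 0 B)
      (tab (a * r / u r c) 0 0 (- (r / u r c)) B) A)
    (tab
      (tab (- (a^2 * c / u r c)) 0 0 (a * c / u r c) B)
      (tab 0 (a^2 * c / u r c) (- (r * R r / (u r c * Q c))) 0 B)
      (tab 0 (r / u r c) (a^2 * c / u r c - Q' c / (2 * Q c)) 0 B)
      (tab (a * c * R r / (u r c * Q c)) 0 0 (Q' c / (2 * Q c) - a^2 * c / u r c) B) A)
    (tab
      (tab 0 (a * r * Q c / (u r c * R r)) (- (a * c / u r c)) 0 B)
      (tab (a * r * R r * Q c / (u r c)^3) 0 0 (- (r * R r * Q c / (u r c)^3)) B)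
      (tab (- (a * c * R r * Q c / (u r c)^3)) 0 0 (a^2 * c * (Q c)^2 / (u r c)^3 - Q c * Q' c / (2 * (u r c)^2)) B)
      (tab 0 (r / u r c) (Q' c / (2 * Q c) - a^2 * c / u r c) 0 B) A)
    K"

definition conn_r :: "4 \<Rightarrow> 4 \<Rightarrow> 4 \<Rightarrow> real \<Rightarrow> real \<Rightarrow> real" where
  "conn_r A B K r c = tab
    (tab
      (tab 0 (2 * r^2 / (u r c)^2 + R'' r / (2 * R r) - 1 / u r c - (R' r)^2 / (2 * (R r)^2)) (- (2 * a^2 * r * c / (u r c)^2)) 0 B)
      (tab (6 * r^2 * (R r)^2 / (u r c)^4 + (R' r)^2 / (2 * (u r c)^2) + R r * R'' r / (2 * (u r c)^2) - (R r)^2 / (u r c)^3 - 4 * r * R r * R' r / (u r c)^3) 0 0 (a * R r * Q c / (u r c)^3 + a * r * R' r * Q c / (u r c)^3 - 6 * a * r^2 * R r * Q c / (u r c)^4) B)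
      (tab (a^2 * c * R' r * Q c / (u r c)^3 - 6 * a^2 * r * c * R r * Q c / (u r c)^4) 0 0 (6 * a * r * c * R r * Q c / (u r c)^4 - a * c * R' r * Q c / (u r c)^3) B)
      (tab 0 (2 * a * r^2 / (u r c)^2 - a / u r c) (a * c * R' r / (u r c * Q c) - 2 * a * r * c * R r / ((u r c)^2 * Q c)) 0 B) A)
    (tab
      (tab (2 * r^2 / (u r c)^2 + R'' r / (2 * R r) - 1 / u r c - (R' r)^2 / (2 * (R r)^2)) 0 0 (a * Q c / (u r c * R r) - 2 * a * r^2 * Q c / ((u r c)^2 * R r) - a * r * R' r * Q c / (u r c * (R r)^2)) B)
      (tab 0 (1 / u r c + (R' r)^2 / (2 * (R r)^2) - 2 * r^2 / (u r c)^2 - R'' r / (2 * R r)) (- (2 * a^2 * r * c / (u r c)^2)) 0 B)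
      (tab 0 (2 * a^2 * r * c * Q c / ((u r c)^2 * R r) + a^2 * c * R' r * Q c / (u r c * (R r)^2)) (1 / u r c - 2 * r^2 / (u r c)^2) 0 B)
      (tab (a / u r c - 2 * a * r^2 / (u r c)^2) 0 0 (2 * r^2 / (u r c)^2 - 1 / u r c) B) A)
    (tab
      (tab (2 * a^2 * r * c / (u r c)^2) 0 0 (- (2 * a * r * c / (u r c)^2)) B)
      (tab 0 (- (2 * a^2 * r * c / (u r c)^2)) (2 * r^2 * R r / ((u r c)^2 * Q c) - R r / (u r c * Q c) - r * R' r / (u r c * Q c)) 0 B)
      (tab 0 (1 / u r c - 2 * r^2 / (u r c)^2) (- (2 * a^2 * r * c / (u r c)^2)) 0 B)
      (tab (a * c * R' r / (u r c * Q c) - 2 * a * r * c * R r / ((u r c)^2 * Q c)) 0 0 (2 * a^2 * r * c / (u r c)^2) B) A)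
    (tab
      (tab 0 (a * Q c / (u r c * R r) - 2 * a * r^2 * Q c / ((u r c)^2 * R r) - a * r * R' r * Q c / (u r c * (R r)^2)) (2 * a * r * c / (u r c)^2) 0 B)
      (tab (a * R r * Q c / (u r c)^3 + a * r * R' r * Q c / (u r c)^3 - 6 * a * r^2 * R r * Q c / (u r c)^4) 0 0 (6 * r^2 * R r * Q c / (u r c)^4 - R r * Q c / (u r c)^3 - r * R' r * Q c / (u r c)^3) B)
      (tab (6 * a * r * c * R r * Q c / (u r c)^4 - a * c * R' r * Q c / (u r c)^3) 0 0 (2 * r * Q c * Q' c / (u r c)^3 - 6 * a^2 * r * c * (Q c)^2 / (u r c)^4) B)
      (tab 0 (1 / u r c - 2 * r^2 / (u r c)^2) (2 * a^2 * r * c / (u r c)^2) 0 B) A)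
    K"

definition conn_c :: "4 \<Rightarrow> 4 \<Rightarrow> 4 \<Rightarrow> real \<Rightarrow> real \<Rightarrow> real" where
  "conn_c A B K r c = tab
    (tab
      (tab 0 (2 * a^2 * r * c / (u r c)^2) (a^2 / u r c - 2 * a^4 * c^2 / (u r c)^2) 0 B)
      (tab (6 * a^2 * r * c * (R r)^2 / (u r c)^4 - 2 * a^2 * c * R r * R' r / (u r c)^3) 0 0 (a * r * R r * Q' c / (u r c)^3 - 6 * a^3 * r * c * R r * Q c / (u r c)^4) B)
      (tab (a^2 * R r * Q c / (u r c)^3 + a^2 * c * R r * Q' c / (u r c)^3 - 6 * a^4 * c^2 * R r * Q c / (u r c)^4) 0 0 (6 * a^3 * c^2 * R r * Q c / (u r c)^4 - a * R r * Q c / (u r c)^3 - a * c * R r * Q' c / (u r c)^3) B)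
      (tab 0 (2 * a^3 * r * c / (u r c)^2) (a * R r / (u r c * Q c) - 2 * a^3 * c^2 * R r / ((u r c)^2 * Q c) - a * c * R r * Q' c / (u r c * (Q c)^2)) 0 B) A)
    (tab
      (tab (2 * a^2 * r * c / (u r c)^2) 0 0 (a * r * Q' c / (u r c * R r) - 2 * a^3 * r * c * Q c / ((u r c)^2 * R r)) B)
      (tab 0 (- (2 * a^2 * r * c / (u r c)^2)) (a^2 / u r c - 2 * a^4 * c^2 / (u r c)^2) 0 B)
      (tab 0 (2 * a^4 * c^2 * Q c / ((u r c)^2 * R r) - a^2 * Q c / (u r c * R r) - a^2 * c * Q' c / (u r c * R r)) (- (2 * a^2 * r * c / (u r c)^2)) 0 B)
      (tab (- (2 * a^3 * r * c / (u r c)^2)) 0 0 (2 * a^2 * r * c / (u r c)^2) B) A)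
    (tab
      (tab (2 * a^4 * c^2 / (u r c)^2 - a^2 / u r c) 0 0 (a / u r c - 2 * a^3 * c^2 / (u r c)^2) B)
      (tab 0 (a^2 / u r c - 2 * a^4 * c^2 / (u r c)^2) (2 * a^2 * r * c * R r / ((u r c)^2 * Q c) + r * R r * Q' c / (u r c * (Q c)^2)) 0 B)
      (tab 0 (- (2 * a^2 * r * c / (u r c)^2)) (a^2 / u r c + (Q' c)^2 / (2 * (Q c)^2) - 2 * a^4 * c^2 / (u r c)^2 - Q'' c / (2 * Q c)) 0 B)
      (tab (a * R r / (u r c * Q c) - 2 * a^3 * c^2 * R r / ((u r c)^2 * Q c) - a * c * R r * Q' c / (u r c * (Q c)^2)) 0 0 (2 * a^4 * c^2 / (u r c)^2 + Q'' c / (2 * Q c) - a^2 / u r c - (Q' c)^2 / (2 * (Q c)^2)) B) A)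
    (tab
      (tab 0 (a * r * Q' c / (u r c * R r) - 2 * a^3 * r * c * Q c / ((u r c)^2 * R r)) (2 * a^3 * c^2 / (u r c)^2 - a / u r c) 0 B)
      (tab (a * r * R r * Q' c / (u r c)^3 - 6 * a^3 * r * c * R r * Q c / (u r c)^4) 0 0 (6 * a^2 * r * c * R r * Q c / (u r c)^4 - r * R r * Q' c / (u r c)^3) B)
      (tab (6 * a^3 * c^2 * R r * Q c / (u r c)^4 - a * R r * Q c / (u r c)^3 - a * c * R r * Q' c / (u r c)^3) 0 0 (a^2 * (Q c)^2 / (u r c)^3 + 4 * a^2 * c * Q c * Q' c / (u r c)^3 - 6 * a^4 * c^2 * (Q c)^2 / (u r c)^4 - (Q' c)^2 / (2 * (u r c)^2) - Q c * Q'' c / (2 * (u r c)^2)) B)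
      (tab 0 (- (2 * a^2 * r * c / (u r c)^2)) (2 * a^4 * c^2 / (u r c)^2 + Q'' c / (2 * Q c) - a^2 / u r c - (Q' c)^2 / (2 * (Q c)^2)) 0 B) A)
    K"

section \<open>Derivatives of the norms and connection coefficients\<close>

lemma DERIV_u_r [derivative_intros]: "((\<lambda>r. u r c) has_real_derivative 2 * r) (at r)"
  unfolding u_def by (auto intro!: derivative_eq_intros)

lemma DERIV_u_c [derivative_intros]: "(u r has_real_derivative 2 * a^2 * c) (at c)"
  unfolding u_def[abs_def] by (auto intro!: derivative_eq_intros)

declare R' [derivative_intros] R'' [derivative_intros] Q' [derivative_intros] Q'' [derivative_intros]

lemma DERIV_norm2:
  assumes "u r c \<noteq> 0" "R r \<noteq> 0" "Q c \<noteq> 0"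
  shows "((\<lambda>r. norm2 A r c) has_real_derivative norm2_r A r c) (at r)"
    and "(norm2 A r has_real_derivative norm2_c A r c) (at c)"
proof -
  have "\<forall>A. ((\<lambda>r. norm2 A r c) has_real_derivative norm2_r A r c) (at r)
      \<and> (norm2 A r has_real_derivative norm2_c A r c) (at c)"
    unfolding forall_4 norm2_def[abs_def] norm2_r_def norm2_c_def tab_simps
    \<comment> \<open>\<open>DERIV_cong\<close> leaves the derivative open: the rules build a raw
      expression, and its equality with the table entry is cleared of denominators and left to
      \<open>algebra\<close>.\<close>
    by (intro conjI; rule DERIV_cong)
       (rule derivative_intros | use assms in \<open>simp; fail\<close> |
         use assms in \<open>simp add: divide_simps\<close>, algebra)+
  then show "((\<lambda>r. norm2 A r c) has_real_derivative norm2_r A r c) (at r)"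
    and "(norm2 A r has_real_derivative norm2_c A r c) (at c)"
    by blast+
qed

lemma DERIV_conn_r:
  assumes "u r c \<noteq> 0" "R r \<noteq> 0" "Q c \<noteq> 0"
  shows "((\<lambda>r. conn A B K r c) has_real_derivative conn_r A B K r c) (at r)"
proof -
  have "\<forall>K A B. ((\<lambda>r. conn A B K r c) has_real_derivative conn_r A B K r c) (at r)"
    unfolding forall_4 conn_def conn_r_def tab_simps
    by (intro conjI; rule DERIV_cong)
       (rule derivative_intros | use assms in \<open>simp; fail\<close> |
         use assms in \<open>simp add: divide_simps\<close>, algebra)+
  then show ?thesis by blast
qed

lemma DERIV_conn_c:
  assumes "u r c \<noteq> 0" "R r \<noteq> 0" "Q c \<noteq> 0"
  shows "(conn A B K r has_real_derivative conn_c A B K r c) (at c)"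
proof -
  have "\<forall>K A B. (conn A B K r has_real_derivative conn_c A B K r c) (at c)"
    unfolding forall_4 conn_def[abs_def] conn_c_def tab_simps
    by (intro conjI; rule DERIV_cong)
       (rule derivative_intros | use assms in \<open>simp; fail\<close> |
         use assms in \<open>simp add: divide_simps\<close>, algebra)+
  then show ?thesis by blast
qed

end

lemma tab_const [simp]: "tab p p p p i = p"
  by (simp add: tab_def)

context carter_functions begin

section \<open>Frame conditions for the Carter metrics\<close>

lemma open_chart: "open chart"
proof -
  have RQ: "continuous_on UNIV R" "continuous_on UNIV Q"
    using R' Q' by (auto intro!: DERIV_continuous_on intro: has_field_derivative_at_within)
  have "continuous_on UNIV (\<lambda>x :: point. R (x $ 2))" "continuous_on UNIV (\<lambda>x :: point. Q (cos (x $ 3)))"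
    by (intro continuous_on_compose2[OF RQ(1)] continuous_on_compose2[OF RQ(2)] continuous_intros; simp)+
  then show ?thesis
    unfolding chart_def u_def
    by (intro open_Collect_conj open_Collect_less open_Collect_neq continuous_intros)
qed

lemma chart_sin: "x \<in> chart \<Longrightarrow> sin (x $ 3) \<noteq> 0"
  unfolding chart_def using sin_gt_zero[of "x $ 3"] by auto

lemma frame_dual:
  assumes x: "x \<in> chart"
  shows "(\<Sum>k\<in>UNIV. coframe A k x * frame B k x) = (if A = B then 1 else 0)"
proof -
  have nz: "\<xi> \<noteq> 0" "u (x $ 2) (cos (x $ 3)) \<noteq> 0" "sin (x $ 3) \<noteq> 0"
    using x \<xi>_nonzero chart_sin[OF x] by (auto simp: chart_def)
  \<comment> \<open>The coframe contains the sine and \<open>u\<close> the cosine; with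
    \<open>u\<close> in terms of the sine, both sides are polynomials in the same variables.\<close>
  have uu: "u (x $ 2) (cos (x $ 3)) = (x $ 2)^2 + a^2 - a^2 * (sin (x $ 3))^2"
    by (simp add: u_def cos_squared_eq algebra_simps)
  have "\<forall>A B. (\<Sum>k\<in>UNIV. coframe A k x * frame B k x) = (if A = B then 1 else 0)"
    unfolding forall_4 sum_4 coframe_def frame_def tab_simps using nz
    by (intro conjI; simp add: divide_simps; (simp add: uu power2_eq_square algebra_simps)?)
  then show ?thesis by blast
qed

lemma has_partial_coframe: "has_partial (coframe A j) i (d_coframe i A j x) x"
proof -
  note r = has_partial_r_theta[of "\<lambda>r \<theta>. - \<xi> * (r\<^sup>2 + a\<^sup>2)" x "- 2 * \<xi> * x $ 2" 0 i]
  note \<theta> = has_partial_r_theta[of "\<lambda>r \<theta>. - \<xi> * a * (sin \<theta>)\<^sup>2" x 0 "- 2 * \<xi> * a * sin (x $ 3) * cos (x $ 3)" i]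
    has_partial_r_theta[of "\<lambda>r \<theta>. - sin \<theta>" x 0 "- cos (x $ 3)" i]
  have "\<forall>A j. has_partial (\<lambda>y. coframe A j y) i (d_coframe i A j x) x"
    unfolding forall_4 coframe_def d_coframe_def tab_simps tab_const
    by (intro conjI; (rule has_partial_const | rule r | rule \<theta>)) (auto intro!: derivative_eq_intros)
  then show ?thesis by simp
qed

lemma has_partial_d_coframe: "has_partial (d_coframe i A j) k (dd_coframe k i A j x) x"
proof -
  note r = has_partial_r_theta[of "\<lambda>r \<theta>. - 2 * \<xi> * r" x "- 2 * \<xi>" 0 k]
  note \<theta> = has_partial_r_theta[of "\<lambda>r \<theta>. - 2 * \<xi> * a * sin \<theta> * cos \<theta>" x 0
      "2 * \<xi> * a * ((sin (x $ 3))\<^sup>2 - (cos (x $ 3))\<^sup>2)" k]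
    has_partial_r_theta[of "\<lambda>r \<theta>. - cos \<theta>" x 0 "sin (x $ 3)" k]
  have "\<forall>i A j. has_partial (\<lambda>y. d_coframe i A j y) k (dd_coframe k i A j x) x"
    unfolding forall_4 d_coframe_def dd_coframe_def tab_simps tab_const
    by (intro conjI; (rule has_partial_const | rule r | rule \<theta>))
       (auto intro!: derivative_eq_intros simp: power2_eq_square algebra_simps)
  then show ?thesis by simp
qed

lemma dd_coframe_commute: "dd_coframe k i A j x = dd_coframe i k A j x"
proof -
  have "\<forall>k i. dd_coframe k i A j x = dd_coframe i k A j x"
    unfolding forall_4 dd_coframe_def tab_simps by simp
  then show ?thesis by simp
qed

lemma has_partial_frame:
  assumes x: "x \<in> chart"
  shows "\<exists>d. has_partial (frame A k) i d x"
proof -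
  have nz: "\<xi> \<noteq> 0" "u (x $ 2) (cos (x $ 3)) \<noteq> 0" "sin (x $ 3) \<noteq> 0"
    using x \<xi>_nonzero chart_sin[OF x] by (auto simp: chart_def)
  have u\<theta>: "((\<lambda>\<theta>. u r (cos \<theta>)) has_real_derivative - 2 * a\<^sup>2 * cos \<theta> * sin \<theta>) (at \<theta>)" for r \<theta>
    unfolding u_def by (auto intro!: derivative_eq_intros)
  have ex: "\<exists>d. has_partial (\<lambda>y. F (y $ 2) (y $ 3)) i d x"
    if "((\<lambda>r. F r (x $ 3)) has_real_derivative Fr) (at (x $ 2))"
      "(F (x $ 2) has_real_derivative F\<theta>) (at (x $ 3))" for F Fr F\<theta>
    using has_partial_r_theta[OF that] by blast
  note F = ex[of "\<lambda>r \<theta>. (r\<^sup>2 + a\<^sup>2) / (\<xi> * u r (cos \<theta>))"] ex[of "\<lambda>r \<theta>. a / (\<xi> * u r (cos \<theta>))"]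
    ex[of "\<lambda>r \<theta>. - 1 / sin \<theta>"] ex[of "\<lambda>r \<theta>. - a * (sin \<theta>)\<^sup>2 / (\<xi> * u r (cos \<theta>))"]
    ex[of "\<lambda>r \<theta>. - 1 / (\<xi> * u r (cos \<theta>))"]
  have "\<forall>A k. \<exists>d. has_partial (\<lambda>y. frame A k y) i d x"
    unfolding forall_4 frame_def tab_simps
    by (intro conjI; ((rule exI, rule has_partial_const) | rule F))
       (rule derivative_intros u\<theta> | use nz in \<open>simp; fail\<close>)+
  then show ?thesis by simp
qed

text \<open>The frame vectors 2 and 3 are the derivatives by r and by c = cos \<theta>, and the
  other two annihilate functions of these. The sum has the shape in which the frame locale expects
  derivatives.\<close>

lemma has_partial_coordinate_function:
  assumes "((\<lambda>r. F r (cos (x $ 3))) has_real_derivative Fr) (at (x $ 2))"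
    and "(F (x $ 2) has_real_derivative Fc) (at (cos (x $ 3)))"
  shows "has_partial (\<lambda>y. F (y $ 2) (cos (y $ 3))) i (\<Sum>C\<in>UNIV. coframe C i x * tab 0 Fr Fc 0 C) x"
proof -
  have "\<forall>i. tab 0 Fr (- sin (x $ 3) * Fc) 0 i = (\<Sum>C\<in>UNIV. coframe C i x * tab 0 Fr Fc 0 C)"
    unfolding forall_4 sum_4 coframe_def tab_simps by simp
  then show ?thesis
    using has_partial_r_cos[OF assms, of i] by simp
qed

lemma coframe_torsion_free:
  assumes x: "x \<in> chart"
  shows "d_coframe i A j x - d_coframe j A i x = (\<Sum>C\<in>UNIV. \<Sum>D\<in>UNIV. coframe C i x * coframe D j x *
    (conn A C D (x $ 2) (cos (x $ 3)) - conn A D C (x $ 2) (cos (x $ 3))))"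
proof -
  define r c where "r = x $ 2" and "c = cos (x $ 3)"
  have nz: "u r c \<noteq> 0" "R r \<noteq> 0" "Q c \<noteq> 0"
    using x by (auto simp: chart_def r_def c_def)
  have uu: "u r c = r^2 + a^2 - a^2 * (sin (x $ 3))^2"
    by (simp add: u_def c_def cos_squared_eq algebra_simps)
  have "\<forall>A i j. d_coframe i A j x - d_coframe j A i x = (\<Sum>C\<in>UNIV. \<Sum>D\<in>UNIV. coframe C i x * coframe D j x *
      (conn A C D r c - conn A D C r c))"
    unfolding forall_4 sum_4 coframe_def d_coframe_def conn_def tab_simps r_def[symmetric] c_def[symmetric]
    using nz
    by (intro conjI; simp add: divide_simps; (simp add: uu power2_eq_square algebra_simps)?)
  then show ?thesis
    unfolding r_def c_def by blast
qed

lemma conn_compatible: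
  assumes "u r c \<noteq> 0" "R r \<noteq> 0" "Q c \<noteq> 0"
  shows "norm2 A r c * conn A B C r c + norm2 B r c * conn B A C r c
    = (if A = B then tab 0 (norm2_r A r c) (norm2_c A r c) 0 C else 0)"
proof -
  have "\<forall>A B C. norm2 A r c * conn A B C r c + norm2 B r c * conn B A C r c
    = (if A = B then tab 0 (norm2_r A r c) (norm2_c A r c) 0 C else 0)"
    unfolding forall_4 conn_def norm2_def norm2_r_def norm2_c_def tab_simps
    using assms by (intro conjI; simp add: divide_simps; algebra?)
  then show ?thesis by blast
qed

end

locale carter_frame = carter_functions +
  fixes g :: metric
  assumes carter_metric: "x \<in> chart \<Longrightarrow>
    g x $ i $ j = (\<Sum>A\<in>UNIV. norm2 A (x $ 2) (cos (x $ 3)) * coframe A i x * coframe A j x)"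

sublocale carter_frame \<subseteq> orthogonal_frame g chart coframe frame d_coframe dd_coframe
  "\<lambda>A x. norm2 A (x $ 2) (cos (x $ 3))"
  "\<lambda>C A x. tab 0 (norm2_r A (x $ 2) (cos (x $ 3))) (norm2_c A (x $ 2) (cos (x $ 3))) 0 C"
  "\<lambda>A B K x. conn A B K (x $ 2) (cos (x $ 3))"
  "\<lambda>C A B K x. tab 0 (conn_r A B K (x $ 2) (cos (x $ 3))) (conn_c A B K (x $ 2) (cos (x $ 3))) 0 C"
proof
  fix x A B K C i j
  assume x: "x \<in> chart"
  then have nz: "u (x $ 2) (cos (x $ 3)) \<noteq> 0" "R (x $ 2) \<noteq> 0" "Q (cos (x $ 3)) \<noteq> 0"
    by (auto simp: chart_def)
  show "norm2 A (x $ 2) (cos (x $ 3)) \<noteq> 0"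
    using nz by (simp add: norm2_def tab_def)
  show "has_partial (\<lambda>x. norm2 A (x $ 2) (cos (x $ 3))) i (\<Sum>C\<in>UNIV. coframe C i x *
      tab 0 (norm2_r A (x $ 2) (cos (x $ 3))) (norm2_c A (x $ 2) (cos (x $ 3))) 0 C) x"
    by (rule has_partial_coordinate_function) (rule DERIV_norm2 nz)+
  show "has_partial (\<lambda>x. conn A B K (x $ 2) (cos (x $ 3))) i (\<Sum>C\<in>UNIV. coframe C i x *
      tab 0 (conn_r A B K (x $ 2) (cos (x $ 3))) (conn_c A B K (x $ 2) (cos (x $ 3))) 0 C) x"
    by (rule has_partial_coordinate_function) (rule DERIV_conn_r DERIV_conn_c nz)+
  show "norm2 A (x $ 2) (cos (x $ 3)) * conn A B C (x $ 2) (cos (x $ 3))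
      + norm2 B (x $ 2) (cos (x $ 3)) * conn B A C (x $ 2) (cos (x $ 3))
    = (if A = B then tab 0 (norm2_r A (x $ 2) (cos (x $ 3))) (norm2_c A (x $ 2) (cos (x $ 3))) 0 C else 0)"
    by (rule conn_compatible) (rule nz)+
qed (use open_chart frame_dual carter_metric has_partial_coframe has_partial_d_coframe dd_coframe_commute
    has_partial_frame coframe_torsion_free in \<open>auto\<close>)

section \<open>Curvature of the Carter family\<close>

lemma levi_civita_symbol_eq_0:
  assumes "n \<noteq> n'" "(vector [i, j, k, l] :: 4^4) $ n = (vector [i, j, k, l] :: 4^4) $ n'"
  shows "levi_civita_symbol i j k l = 0"
proof -
  have "\<not> inj (\<lambda>n. (vector [i, j, k, l] :: 4^4) $ n)"
    using assms by (auto dest: injD)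
  then show ?thesis
    unfolding levi_civita_symbol_def Let_def using permutes_inj by auto
qed

lemma levi_civita_symbol_repeated [simp]:
  "levi_civita_symbol i i k l = 0" "levi_civita_symbol i j i l = 0" "levi_civita_symbol i j k i = 0"
  "levi_civita_symbol i j j l = 0" "levi_civita_symbol i j k j = 0" "levi_civita_symbol i j k k = 0"
  using levi_civita_symbol_eq_0[of 1 2] levi_civita_symbol_eq_0[of 1 3] levi_civita_symbol_eq_0[of 1 4]
    levi_civita_symbol_eq_0[of 2 3] levi_civita_symbol_eq_0[of 2 4] levi_civita_symbol_eq_0[of 3 4]
  by simp_all

lemma levi_civita_symbol_simps [simp]:
  "levi_civita_symbol 1 2 3 4 = 1" "levi_civita_symbol 1 2 4 3 = - 1" "levi_civita_symbol 1 3 2 4 = - 1"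
  "levi_civita_symbol 1 3 4 2 = 1" "levi_civita_symbol 1 4 2 3 = 1" "levi_civita_symbol 1 4 3 2 = - 1"
  "levi_civita_symbol 2 1 3 4 = - 1" "levi_civita_symbol 2 1 4 3 = 1" "levi_civita_symbol 2 3 1 4 = 1"
  "levi_civita_symbol 2 3 4 1 = - 1" "levi_civita_symbol 2 4 1 3 = - 1" "levi_civita_symbol 2 4 3 1 = 1"
  "levi_civita_symbol 3 1 2 4 = 1" "levi_civita_symbol 3 1 4 2 = - 1" "levi_civita_symbol 3 2 1 4 = - 1"
  "levi_civita_symbol 3 2 4 1 = 1" "levi_civita_symbol 3 4 1 2 = 1" "levi_civita_symbol 3 4 2 1 = - 1"
  "levi_civita_symbol 4 1 2 3 = - 1" "levi_civita_symbol 4 1 3 2 = 1" "levi_civita_symbol 4 2 1 3 = 1"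
  "levi_civita_symbol 4 2 3 1 = - 1" "levi_civita_symbol 4 3 1 2 = - 1" "levi_civita_symbol 4 3 2 1 = 1"
  by (simp_all add: levi_civita_symbol_eq)

context carter_functions begin

text \<open>Type D splits the tangent space into the planes of frame vectors 1, 2 and 3, 4; the
  principal null directions lie in the first.\<close>

definition same_block :: "4 \<Rightarrow> 4 \<Rightarrow> bool" where
  "same_block A B \<longleftrightarrow> (A \<in> {1, 2} \<longleftrightarrow> B \<in> {1, 2})"

text \<open>The Weyl tensor of type D weights the bivectors \<open>12\<close>, \<open>34\<close> by \<open>- 2\<close> and the four others by \<open>1\<close>.\<close>

definition block_factor :: "4 \<Rightarrow> 4 \<Rightarrow> real" where
  "block_factor A B = (if same_block A B then - 2 else 1)"

text \<open>The sectional curvature of the plane 12. The two definitions after it do the same for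
  the four mixed planes, which share one value, and for the plane 34.\<close>

definition sectional_radial :: "real \<Rightarrow> real \<Rightarrow> real" where
  "sectional_radial r c = (4 * r * R' r - 6 * R r + 6 * a^2 * Q c) / (2 * (u r c)^2) - R'' r / (2 * u r c)
    + 4 * a^2 * c^2 * (R r - a^2 * Q c) / (u r c)^3"

definition sectional_mixed :: "real \<Rightarrow> real \<Rightarrow> real" where
  "sectional_mixed r c = (2 * R r - r * R' r - 2 * a^2 * Q c - a^2 * c * Q' c) / (2 * (u r c)^2)
    - 2 * a^2 * c^2 * (R r - a^2 * Q c) / (u r c)^3"

definition sectional_angular :: "real \<Rightarrow> real \<Rightarrow> real" where
  "sectional_angular r c = (4 * a^2 * c * Q' c - 2 * R r + 2 * a^2 * Q c) / (2 * (u r c)^2) - Q'' c / (2 * u r c)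
    + 4 * a^2 * c^2 * (R r - a^2 * Q c) / (u r c)^3"

definition sectional :: "4 \<Rightarrow> 4 \<Rightarrow> real \<Rightarrow> real \<Rightarrow> real" where
  "sectional A B r c = (if \<not> same_block A B then sectional_mixed r c else if A \<in> {1, 2} then sectional_radial r c else sectional_angular r c)"

text \<open>The scalar \<open>Y\<close>: up to \<open>block_factor\<close> and signs, the Riemann
  components with four different indices. Metric and Ricci tensor are diagonal in the frame, so
  removing traces does not change these components.\<close>

definition weyl_odd :: "real \<Rightarrow> real \<Rightarrow> real" where
  "weyl_odd r c = (a * c * R' r - a * r * Q' c) / (2 * (u r c)^2) - 2 * a * r * c * (R r - a^2 * Q c) / (u r c)^3"

text \<open>The scalar \<open>X\<close>: what is left of a mixed sectional curvature after the
  traces are removed. The planes 12 and 34 are left with \<open>- 2\<close> times this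
  value.\<close>

definition weyl_even :: "real \<Rightarrow> real \<Rightarrow> real" where
  "weyl_even r c = (2 * sectional_mixed r c - sectional_radial r c - sectional_angular r c) / 6"

definition pair_delta :: "4 \<Rightarrow> 4 \<Rightarrow> 4 \<Rightarrow> 4 \<Rightarrow> real" where
  "pair_delta A B C D = of_bool (A = C \<and> B = D) - of_bool (A = D \<and> B = C)"

text \<open>\<open>frame_riemann\<close> read as an expression in two real variables, so that the
  component identities mention neither a metric nor a chart point.\<close>

definition conn_curvature :: "4 \<Rightarrow> 4 \<Rightarrow> 4 \<Rightarrow> 4 \<Rightarrow> real \<Rightarrow> real \<Rightarrow> real" where
  "conn_curvature A B C D r c = tab 0 (conn_r A B D r c) (conn_c A B D r c) 0 C
    - tab 0 (conn_r A B C r c) (conn_c A B C r c) 0 D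
    + (\<Sum>F\<in>UNIV. conn A F C r c * conn F B D r c - conn A F D r c * conn F B C r c
        + (conn F C D r c - conn F D C r c) * conn A B F r c)"

definition carter_riemann :: "4 \<Rightarrow> 4 \<Rightarrow> 4 \<Rightarrow> 4 \<Rightarrow> real \<Rightarrow> real \<Rightarrow> real" where
  "carter_riemann A B C D r c = norm2 B r c * sectional A B r c * pair_delta A B C D
    - block_factor A B * weyl_odd r c * levi_civita_symbol A B C D / norm2 A r c"

lemmas curvature_eval = conn_curvature_def carter_riemann_def sum_4 conn_def conn_r_def conn_c_def sectional_def same_block_def
  block_factor_def pair_delta_def norm2_def sectional_mixed_def sectional_radial_def sectional_angular_def weyl_odd_def

text \<open>As a congruence rule this lets the simplifier work on the index only, so an entry is
  selected before the large tables are simplified.\<close>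

lemma tab_weak_cong: "i = j \<Longrightarrow> tab p q r s i = tab p q r s j"
  by simp

text \<open>With the inverses as indeterminates, every component is an identity modulo the three
  polynomial relations \<open>inv(4-6)\<close>; this keeps the degrees low.\<close>

context
  fixes r c v \<rho> \<kappa>
  assumes inv: "inverse (u r c) = v" "inverse (R r) = \<rho>" "inverse (Q c) = \<kappa>"
    "v * (r^2 + a^2 * c^2) = 1" "\<rho> * R r = 1" "\<kappa> * Q c = 1"
begin

lemma denominators_nonzero: "u r c \<noteq> 0" "R r \<noteq> 0" "Q c \<noteq> 0"
  using inv by (auto simp: u_def)

text \<open>On these components the Groebner basis search with \<open>inv(4-6)\<close> fails or does not terminate.\<close>

lemma curvature_exceptional:
  "conn_curvature 3 1 1 2 r c = carter_riemann 3 1 1 2 r c" "conn_curvature 1 2 1 3 r c = carter_riemann 1 2 1 3 r c"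
  "conn_curvature 4 4 1 4 r c = carter_riemann 4 4 1 4 r c" "conn_curvature 4 3 2 4 r c = carter_riemann 4 3 2 4 r c"
  "conn_curvature 2 4 3 4 r c = carter_riemann 2 4 3 4 r c" "conn_curvature 4 2 3 4 r c = carter_riemann 4 2 3 4 r c"
  using denominators_nonzero
  by (simp add: curvature_eval cong: tab_weak_cong; (simp add: divide_simps)?; simp only: u_def; algebra)+

text \<open>Both sides are antisymmetric in the last two indices, so six index pairs with sixteen
  components each cover everything; this and the next five lemmas treat one pair each.\<close>

lemma curvature_12: "conn_curvature A B 1 2 r c = carter_riemann A B 1 2 r c"
proof -
  have "\<forall>A B. conn_curvature A B 1 2 r c = carter_riemann A B 1 2 r c"
    unfolding forall_4
    \<comment> \<open>Per component there are three alternatives: the exceptional list; clearing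
      denominators, with \<open>u_def\<close> as a side relation; or replacing all inverses by
      indeterminates and reducing modulo \<open>inv(4-6)\<close>.\<close>
    by (intro conjI; (rule curvature_exceptional
        | use denominators_nonzero in \<open>simp add: curvature_eval cong: tab_weak_cong; (simp add: divide_simps)?;
            (use u_def[of r c] in algebra)\<close>
        | simp add: curvature_eval cong: tab_weak_cong;
            (simp only: divide_inverse inverse_mult_distrib power_inverse[symmetric] inv(1-3))?;
            (simp only: u_def)?; (use inv(4-6) in algebra)))
  then show ?thesis by blast
qed

lemma curvature_13: "conn_curvature A B 1 3 r c = carter_riemann A B 1 3 r c"
proof -
  have "\<forall>A B. conn_curvature A B 1 3 r c = carter_riemann A B 1 3 r c"
    unfolding forall_4
    by (intro conjI; (rule curvature_exceptional
        | use denominators_nonzero in \<open>simp add: curvature_eval cong: tab_weak_cong; (simp add: divide_simps)?;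
            (use u_def[of r c] in algebra)\<close>
        | simp add: curvature_eval cong: tab_weak_cong;
            (simp only: divide_inverse inverse_mult_distrib power_inverse[symmetric] inv(1-3))?;
            (simp only: u_def)?; (use inv(4-6) in algebra)))
  then show ?thesis by blast
qed

lemma curvature_14: "conn_curvature A B 1 4 r c = carter_riemann A B 1 4 r c"
proof -
  have "\<forall>A B. conn_curvature A B 1 4 r c = carter_riemann A B 1 4 r c"
    unfolding forall_4
    by (intro conjI; (rule curvature_exceptional
        | use denominators_nonzero in \<open>simp add: curvature_eval cong: tab_weak_cong; (simp add: divide_simps)?;
            (use u_def[of r c] in algebra)\<close>
        | simp add: curvature_eval cong: tab_weak_cong;
            (simp only: divide_inverse inverse_mult_distrib power_inverse[symmetric] inv(1-3))?;
            (simp only: u_def)?; (use inv(4-6) in algebra)))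
  then show ?thesis by blast
qed

lemma curvature_23: "conn_curvature A B 2 3 r c = carter_riemann A B 2 3 r c"
proof -
  have "\<forall>A B. conn_curvature A B 2 3 r c = carter_riemann A B 2 3 r c"
    unfolding forall_4
    by (intro conjI; (rule curvature_exceptional
        | use denominators_nonzero in \<open>simp add: curvature_eval cong: tab_weak_cong; (simp add: divide_simps)?;
            (use u_def[of r c] in algebra)\<close>
        | simp add: curvature_eval cong: tab_weak_cong;
            (simp only: divide_inverse inverse_mult_distrib power_inverse[symmetric] inv(1-3))?;
            (simp only: u_def)?; (use inv(4-6) in algebra)))
  then show ?thesis by blast
qed

lemma curvature_24: "conn_curvature A B 2 4 r c = carter_riemann A B 2 4 r c"
proof -
  have "\<forall>A B. conn_curvature A B 2 4 r c = carter_riemann A B 2 4 r c"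
    unfolding forall_4
    by (intro conjI; (rule curvature_exceptional
        | use denominators_nonzero in \<open>simp add: curvature_eval cong: tab_weak_cong; (simp add: divide_simps)?;
            (use u_def[of r c] in algebra)\<close>
        | simp add: curvature_eval cong: tab_weak_cong;
            (simp only: divide_inverse inverse_mult_distrib power_inverse[symmetric] inv(1-3))?;
            (simp only: u_def)?; (use inv(4-6) in algebra)))
  then show ?thesis by blast
qed

lemma curvature_34: "conn_curvature A B 3 4 r c = carter_riemann A B 3 4 r c"
proof -
  have "\<forall>A B. conn_curvature A B 3 4 r c = carter_riemann A B 3 4 r c"
    unfolding forall_4
    by (intro conjI; (rule curvature_exceptional
        | use denominators_nonzero in \<open>simp add: curvature_eval cong: tab_weak_cong; (simp add: divide_simps)?;
            (use u_def[of r c] in algebra)\<close>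
        | simp add: curvature_eval cong: tab_weak_cong;
            (simp only: divide_inverse inverse_mult_distrib power_inverse[symmetric] inv(1-3))?;
            (simp only: u_def)?; (use inv(4-6) in algebra)))
  then show ?thesis by blast
qed

end

lemma conn_curvature_eq:
  assumes nz: "u r c \<noteq> 0" "R r \<noteq> 0" "Q c \<noteq> 0"
  shows "conn_curvature A B C D r c = carter_riemann A B C D r c"
proof -
  \<comment> \<open>For equal last indices antisymmetry forces both sides to be 0; for the others it
    reduces to the six ordered pairs.\<close>
  have anti: "conn_curvature A B C D r c = - conn_curvature A B D C r c" "carter_riemann A B C D r c = - carter_riemann A B D C r c" for C D
  proof -
    have "levi_civita_symbol A B C D = - levi_civita_symbol A B D C"
      using levi_civita_symbol_eq[of A B C D] levi_civita_symbol_eq[of A B D C]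
      by (simp add: Let_def conj_commute)
    then show "carter_riemann A B C D r c = - carter_riemann A B D C r c"
      by (simp add: carter_riemann_def pair_delta_def algebra_simps)
  qed (simp add: conn_curvature_def sum_4 algebra_simps)
  have "inverse (u r c) * (r^2 + a^2 * c^2) = 1" "inverse (R r) * R r = 1" "inverse (Q c) * Q c = 1"
    using nz by (simp_all add: u_def)
  note inv = refl refl refl this
  have "\<forall>C D. conn_curvature A B C D r c = carter_riemann A B C D r c"
    unfolding forall_4
    using curvature_12[OF inv] curvature_13[OF inv] curvature_14[OF inv] curvature_23[OF inv] curvature_24[OF inv] curvature_34[OF inv]
      anti[of 1 1] anti[of 2 2] anti[of 3 3] anti[of 4 4]
      anti[of 2 1] anti[of 3 1] anti[of 4 1] anti[of 3 2] anti[of 4 2] anti[of 4 3]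
    by simp
  then show ?thesis by blast
qed

end

section \<open>Ricci and Weyl tensors of the Carter family and the dual contraction\<close>

context carter_functions begin

text \<open>A Ricci eigenvalue is the sum of the sectional curvatures of the three planes through
  the frame vector: one inside its block and two mixed.\<close>

definition block_ricci :: "4 \<Rightarrow> real \<Rightarrow> real \<Rightarrow> real" where
  "block_ricci A r c = (if A \<in> {1, 2} then sectional_radial r c else sectional_angular r c) + 2 * sectional_mixed r c"

definition carter_weyl :: "4 \<Rightarrow> 4 \<Rightarrow> 4 \<Rightarrow> 4 \<Rightarrow> real \<Rightarrow> real \<Rightarrow> real" where
  "carter_weyl A B C D r c = block_factor A B *
    (weyl_even r c * (norm2 A r c * norm2 B r c) * pair_delta A B C D - weyl_odd r c * levi_civita_symbol A B C D)"

text \<open>The norms cancel because their product is \<open>- 1\<close>. Each of the 24 quadruples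
  contributes 4 X Y times a squared block factor, which is 4 for 8 of them and 1 for 16: 4 * (8 * 4
  + 16) = 192.\<close>

lemma sum_carter_weyl:
  assumes nz: "u r c \<noteq> 0" "R r \<noteq> 0" "Q c \<noteq> 0"
  shows "(\<Sum>A\<in>UNIV. \<Sum>B\<in>UNIV. \<Sum>K\<in>UNIV. \<Sum>L\<in>UNIV. levi_civita_symbol A B K L *
      (\<Sum>C\<in>UNIV. \<Sum>D\<in>UNIV. carter_weyl K L C D r c / (norm2 K r c * norm2 L r c) *
        (carter_weyl A B C D r c / (norm2 A r c * norm2 B r c * norm2 C r c * norm2 D r c))))
    = 192 * weyl_even r c * weyl_odd r c"
proof -
  define g1 g3 X Y where "g1 = norm2 1 r c" and "g3 = norm2 3 r c" and "X = weyl_even r c" and "Y = weyl_odd r c"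
  have g: "norm2 1 r c = g1" "norm2 2 r c = - 1 / g1" "norm2 3 r c = g3" "norm2 4 r c = 1 / g3"
    "g1 \<noteq> 0" "g3 \<noteq> 0"
    using nz by (simp_all add: g1_def g3_def norm2_def divide_simps)
  show ?thesis
    unfolding sum_levi_civita carter_weyl_def X_def[symmetric] Y_def[symmetric]
    using g(5,6)
    by (simp add: sum_4 g(1-4) pair_delta_def block_factor_def same_block_def)
qed

end

context carter_frame begin

context
  fixes x r c
  assumes x: "x \<in> chart" and r: "r = x $ 2" and c: "c = cos (x $ 3)"
begin

lemma chart_nonzero: "u r c \<noteq> 0" "R r \<noteq> 0" "Q c \<noteq> 0" "norm2 A r c \<noteq> 0"
  using x G_nonzero[OF x] by (auto simp: chart_def r c)

lemma frame_riemann_carter: "frame_riemann A B C D x = carter_riemann A B C D r c"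
  using conn_curvature_eq[OF chart_nonzero(1-3)] by (simp add: frame_riemann_def conn_curvature_def r c)

lemma frame_ricci_carter: "frame_ricci B D x = (if B = D then norm2 B r c * block_ricci B r c else 0)"
proof -
  have "\<forall>B D. frame_ricci B D x = (if B = D then norm2 B r c * block_ricci B r c else 0)"
    unfolding forall_4 frame_ricci_def frame_riemann_carter carter_riemann_def sum_4
    by (simp add: pair_delta_def sectional_def same_block_def block_ricci_def algebra_simps)
  then show ?thesis by blast
qed

lemma frame_scalar_carter: "frame_scalar x = 2 * sectional_radial r c + 2 * sectional_angular r c + 8 * sectional_mixed r c"
  unfolding frame_scalar_def frame_ricci_carter sum_4
  using chart_nonzero(4) by (simp add: block_ricci_def flip: r c)

lemma frame_weyl_carter: "frame_weyl A B C D x = carter_weyl A B C D r c"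
proof -
  \<comment> \<open>Metric and Ricci tensor are diagonal in the frame, so every trace term lives on
    one of these two index patterns.\<close>
  define p q where "p = (of_bool (A = C \<and> B = D) :: real)" and "q = (of_bool (A = D \<and> B = C) :: real)"
  let ?G = "norm2 A r c * norm2 B r c"
  have G: "frame_metric A C x = (if A = C then norm2 A r c else 0)" for A C
    by (simp add: frame_metric_def r c)
  have d: "frame_metric A C x * frame_ricci B D x = p * (?G * block_ricci B r c)"
    "frame_metric A D x * frame_ricci B C x = q * (?G * block_ricci B r c)"
    "frame_metric B C x * frame_ricci A D x = q * (?G * block_ricci A r c)"
    "frame_metric B D x * frame_ricci A C x = p * (?G * block_ricci A r c)"
    "frame_metric A C x * frame_metric B D x = p * ?G"
    "frame_metric A D x * frame_metric B C x = q * ?G"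
    unfolding G frame_ricci_carter p_def q_def by auto
  have "sectional A B r c - (block_ricci A r c + block_ricci B r c) / 2 + frame_scalar x / 6 = block_factor A B * weyl_even r c"
    unfolding frame_scalar_carter
    by (auto simp: sectional_def block_factor_def same_block_def block_ricci_def weyl_even_def field_simps)
  then have s: "block_factor A B * weyl_even r c = sectional A B r c - (block_ricci A r c + block_ricci B r c) / 2 + frame_scalar x / 6"
    by simp
  have "carter_weyl A B C D r c = ?G * (p - q) * (block_factor A B * weyl_even r c)
      - block_factor A B * weyl_odd r c * levi_civita_symbol A B C D"
    by (simp add: carter_weyl_def pair_delta_def p_def q_def algebra_simps)
  also have "\<dots> = frame_weyl A B C D x"
    unfolding s frame_weyl_def d frame_riemann_carter carter_riemann_def
    using chart_nonzero(4) by (simp add: pair_delta_def field_simps flip: p_def q_def r c)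
  finally show ?thesis by simp
qed

text \<open>The minus signs of frame vectors 3 and 4 cancel and \<open>\<xi>\<close> enters squared;
  the determinant is 1 / (\<xi>^2 u sin \<theta>). This fixes the sign left open by
  \<open>sqrt_det_metric\<close>.\<close>

lemma det_frame_pos: "det (\<chi> A k. frame A k x) > 0"
proof -
  have "\<xi> \<noteq> 0" "sin (x $ 3) > 0"
    using x \<xi>_nonzero sin_gt_zero[of "x $ 3"] by (auto simp: chart_def)
  have "u r c > 0"
    using chart_nonzero(1) by (simp add: u_def less_le)
  define f where "f = (\<lambda>A k. frame A k x)"
  have det: "det (\<chi> A k. f A k) = (\<Sum>i\<in>UNIV. \<Sum>j\<in>UNIV. \<Sum>k\<in>UNIV. \<Sum>l\<in>UNIV.
      levi_civita_symbol i j k l * (f 1 i * f 2 j * f 3 k * f 4 l))"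
    unfolding sum_levi_civita_rows by simp
  have "det (\<chi> A k. frame A k x) = ((x $ 2)\<^sup>2 + a\<^sup>2 - a\<^sup>2 * (sin (x $ 3))\<^sup>2) / (\<xi>\<^sup>2 * (u r c)\<^sup>2 * sin (x $ 3))"
    unfolding det[unfolded sum_levi_civita, unfolded f_def]
    using \<open>\<xi> \<noteq> 0\<close> \<open>sin (x $ 3) > 0\<close> \<open>u r c > 0\<close>
    by (simp add: frame_def r[symmetric] c[symmetric] field_simps power2_eq_square)
  also have "(x $ 2)\<^sup>2 + a\<^sup>2 - a\<^sup>2 * (sin (x $ 3))\<^sup>2 = u r c"
    by (simp add: u_def r c sin_squared_eq algebra_simps)
  finally show ?thesis
    using \<open>\<xi> \<noteq> 0\<close> \<open>sin (x $ 3) > 0\<close> \<open>u r c > 0\<close> by simp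
qed

lemma dual_weyl_weyl_carter: "dual_weyl_weyl g x = 96 * weyl_even r c * weyl_odd r c"
proof -
  have "(\<Prod>A\<in>UNIV. norm2 A (x $ 2) (cos (x $ 3))) = - 1"
    unfolding r[symmetric] c[symmetric] prod_4 norm2_def using chart_nonzero(1-3) by simp
  then have "sqrt \<bar>det (g x)\<bar> * det (\<chi> A k. frame A k x) = 1"
    using sqrt_det_metric[OF x] det_frame_pos by simp
  then show ?thesis
    unfolding dual_weyl_weyl_eq[OF x] frame_weyl_carter r[symmetric] c[symmetric]
      sum_carter_weyl[OF chart_nonzero(1-3)] by simp
qed

end

text \<open>The assumption on \<open>k\<close> admits any closed form of the contraction, so that
  only this form has to be differentiated.\<close>

lemma I6_carter:
  assumes x: "x \<in> chart"
    and k: "\<And>r c. u r c \<noteq> 0 \<Longrightarrow> R r \<noteq> 0 \<Longrightarrow> Q c \<noteq> 0 \<Longrightarrow> 96 * weyl_even r c * weyl_odd r c = k r c"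
    and kr: "((\<lambda>r. k r (cos (x $ 3))) has_real_derivative kr) (at (x $ 2))"
    and kc: "(k (x $ 2) has_real_derivative kc) (at (cos (x $ 3)))"
  shows "I6 g x = (R (x $ 2) * kr\<^sup>2 + Q (cos (x $ 3)) * kc\<^sup>2) / u (x $ 2) (cos (x $ 3))"
proof -
  have eq: "dual_weyl_weyl g y = k (y $ 2) (cos (y $ 3))" if "y \<in> chart" for y
    using dual_weyl_weyl_carter[OF that refl refl] k that by (simp add: chart_def)
  have "has_partial (dual_weyl_weyl g) i (low x (tab 0 kr kc 0) i) x" for i
    unfolding low_def
    by (rule has_partial_cong[THEN iffD2, OF open_chart x eq], assumption)
       (rule has_partial_coordinate_function[OF kr kc])
  then have partial: "partial i (dual_weyl_weyl g) x = low x (tab 0 kr kc 0) i" for i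
    by (rule partial_eqI)
  show ?thesis
    unfolding I6_eq[OF x] partial frame_low[OF x] sum_4
    using chart_nonzero[OF x refl refl] by (simp add: norm2_def add_divide_distrib mult.commute)
qed

end

section \<open>The Kerr-Newman-(anti-)de Sitter metric\<close>

text \<open>Real and imaginary part of \<open>(q\<^sup>2 - m w) w\<^sup>2\<close>, where \<open>w = r + i a c\<close>.\<close>

definition kn_re :: "real \<Rightarrow> real \<Rightarrow> real \<Rightarrow> real \<Rightarrow> real \<Rightarrow> real" where
  "kn_re a m q r c = q^2 * (r^2 - a^2 * c^2) - m * (r^3 - 3 * r * a^2 * c^2)"

definition kn_im :: "real \<Rightarrow> real \<Rightarrow> real \<Rightarrow> real \<Rightarrow> real \<Rightarrow> real" where
  "kn_im a m q r c = 2 * q^2 * r * a * c - m * (3 * r^2 * a * c - a^3 * c^3)"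

text \<open>The r-derivative of 96 X Y = -96 re im / u^6; a factor u^5 of the quotient rule is
  already cancelled. The c-derivative below has the same form.\<close>

definition kn_pontryagin_r :: "real \<Rightarrow> real \<Rightarrow> real \<Rightarrow> real \<Rightarrow> real \<Rightarrow> real" where
  "kn_pontryagin_r a m q r c =
    - 96 * (((2 * q^2 * r - m * (3 * r^2 - 3 * a^2 * c^2)) * kn_im a m q r c
      + kn_re a m q r c * (2 * q^2 * a * c - 6 * m * r * a * c)) * (r^2 + a^2 * c^2)
      - 12 * r * kn_re a m q r c * kn_im a m q r c) / (r^2 + a^2 * c^2)^7"

definition kn_pontryagin_c :: "real \<Rightarrow> real \<Rightarrow> real \<Rightarrow> real \<Rightarrow> real \<Rightarrow> real" where
  "kn_pontryagin_c a m q r c =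
    - 96 * (((6 * m * r * a^2 * c - 2 * q^2 * a^2 * c) * kn_im a m q r c
      + kn_re a m q r c * (2 * q^2 * r * a - m * (3 * r^2 * a - 3 * a^3 * c^2))) * (r^2 + a^2 * c^2)
      - 12 * a^2 * c * kn_re a m q r c * kn_im a m q r c) / (r^2 + a^2 * c^2)^7"

definition kn_I6 :: "real \<Rightarrow> real \<Rightarrow> real \<Rightarrow> real \<Rightarrow> real \<Rightarrow> real \<Rightarrow> real" where
  "kn_I6 a m q \<Lambda> r c = (Delta_r a m q \<Lambda> r * (kn_pontryagin_r a m q r c)^2
    + (1 + a^2 * \<Lambda> / 3 * c^2) * (1 - c^2) * (kn_pontryagin_c a m q r c)^2) / (r^2 + a^2 * c^2)"

lemma kn_pontryagin_DERIV:
  assumes "r^2 + a^2 * c^2 \<noteq> 0"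
  shows "((\<lambda>r. - 96 * kn_re a m q r c * kn_im a m q r c / (r^2 + a^2 * c^2)^6)
      has_real_derivative kn_pontryagin_r a m q r c) (at r)"
    and "((\<lambda>c. - 96 * kn_re a m q r c * kn_im a m q r c / (r^2 + a^2 * c^2)^6)
      has_real_derivative kn_pontryagin_c a m q r c) (at c)"
proof -
  \<comment> \<open>Stated for generic terms, so that u^5 is cancelled before any polynomial is
    expanded.\<close>
  have quot: "(f' * v^6 - f * (6 * v^5 * v')) / (v^6 * v^6) = (f' * v - 6 * f * v') / v^7"
    if "v \<noteq> 0" for f f' v v' :: real
    using that by (simp add: divide_simps) algebra
  have u: "((\<lambda>r. (r^2 + a^2 * c^2)^6) has_real_derivative 6 * (r^2 + a^2 * c^2)^5 * (2 * r)) (at r)"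
    "((\<lambda>c. (r^2 + a^2 * c^2)^6) has_real_derivative 6 * (r^2 + a^2 * c^2)^5 * (2 * a^2 * c)) (at c)"
    by (auto intro!: derivative_eq_intros)
  have re: "((\<lambda>r. kn_re a m q r c) has_real_derivative 2 * q^2 * r - m * (3 * r^2 - 3 * a^2 * c^2)) (at r)"
    "((\<lambda>c. kn_re a m q r c) has_real_derivative 6 * m * r * a^2 * c - 2 * q^2 * a^2 * c) (at c)"
    unfolding kn_re_def by (auto intro!: derivative_eq_intros simp: algebra_simps)
  have im: "((\<lambda>r. kn_im a m q r c) has_real_derivative 2 * q^2 * a * c - 6 * m * r * a * c) (at r)"
    "((\<lambda>c. kn_im a m q r c) has_real_derivative 2 * q^2 * r * a - m * (3 * r^2 * a - 3 * a^3 * c^2)) (at c)"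
    unfolding kn_im_def by (auto intro!: derivative_eq_intros simp: algebra_simps)
  have nz: "(r^2 + a^2 * c^2)^6 \<noteq> 0"
    using assms by simp
  show "((\<lambda>r. - 96 * kn_re a m q r c * kn_im a m q r c / (r^2 + a^2 * c^2)^6)
      has_real_derivative kn_pontryagin_r a m q r c) (at r)"
    by (rule DERIV_cong[OF DERIV_divide[OF DERIV_mult[OF DERIV_cmult[OF re(1)] im(1)] u(1) nz]])
       (subst quot[OF assms], simp add: kn_pontryagin_r_def algebra_simps)
  show "((\<lambda>c. - 96 * kn_re a m q r c * kn_im a m q r c / (r^2 + a^2 * c^2)^6)
      has_real_derivative kn_pontryagin_c a m q r c) (at c)"
    by (rule DERIV_cong[OF DERIV_divide[OF DERIV_mult[OF DERIV_cmult[OF re(2)] im(2)] u(2) nz]])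
       (subst quot[OF assms], simp add: kn_pontryagin_c_def algebra_simps)
qed

definition kn_R' :: "real \<Rightarrow> real \<Rightarrow> real \<Rightarrow> real \<Rightarrow> real" where
  "kn_R' a m \<Lambda> r = 2 * r - 4 * \<Lambda> / 3 * r^3 - 2 * \<Lambda> / 3 * a^2 * r - 2 * m"

definition kn_R'' :: "real \<Rightarrow> real \<Rightarrow> real \<Rightarrow> real" where
  "kn_R'' a \<Lambda> r = 2 - 4 * \<Lambda> * r^2 - 2 * \<Lambda> / 3 * a^2"

definition kn_Q :: "real \<Rightarrow> real \<Rightarrow> real \<Rightarrow> real" where
  "kn_Q a \<Lambda> c = (1 + a^2 * \<Lambda> / 3 * c^2) * (1 - c^2)"

definition kn_Q' :: "real \<Rightarrow> real \<Rightarrow> real \<Rightarrow> real" where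
  "kn_Q' a \<Lambda> c = 2 * a^2 * \<Lambda> / 3 * c - 2 * c - 4 * a^2 * \<Lambda> / 3 * c^3"

definition kn_Q'' :: "real \<Rightarrow> real \<Rightarrow> real \<Rightarrow> real" where
  "kn_Q'' a \<Lambda> c = 2 * a^2 * \<Lambda> / 3 - 2 - 4 * a^2 * \<Lambda> * c^2"

lemma kn_DERIV:
  "(Delta_r a m q \<Lambda> has_real_derivative kn_R' a m \<Lambda> r) (at r)"
  "(kn_R' a m \<Lambda> has_real_derivative kn_R'' a \<Lambda> r) (at r)"
  "(kn_Q a \<Lambda> has_real_derivative kn_Q' a \<Lambda> r) (at r)"
  "(kn_Q' a \<Lambda> has_real_derivative kn_Q'' a \<Lambda> r) (at r)"
  unfolding Delta_r_def[abs_def] kn_R'_def[abs_def] kn_R''_def kn_Q_def[abs_def] kn_Q'_def[abs_def] kn_Q''_def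
  by ((rule derivative_eq_intros refl)+, simp, algebra)
     (auto intro!: derivative_eq_intros simp: power2_eq_square power3_eq_cube algebra_simps add_divide_distrib diff_divide_distrib)

lemma kn_carter_functions:
  "Xi a \<Lambda> \<noteq> 0 \<Longrightarrow> carter_functions (1 / Xi a \<Lambda>)
    (Delta_r a m q \<Lambda>) (kn_R' a m \<Lambda>) (kn_R'' a \<Lambda>) (kn_Q a \<Lambda>) (kn_Q' a \<Lambda>) (kn_Q'' a \<Lambda>)"
  by unfold_locales (auto intro: kn_DERIV)

lemma kn_Q_cos: "kn_Q a \<Lambda> (cos \<theta>) = Delta_theta a \<Lambda> \<theta> * (sin \<theta>)\<^sup>2"
  by (simp add: kn_Q_def Delta_theta_def sin_squared_eq)

section \<open>Specialisation of the Carter frame to the given metric\<close>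

context
  fixes a m q \<Lambda> :: real
  assumes Xi: "Xi a \<Lambda> \<noteq> 0"
begin

interpretation carter_functions a "1 / Xi a \<Lambda>" "Delta_r a m q \<Lambda>" "kn_R' a m \<Lambda>" "kn_R'' a \<Lambda>"
  "kn_Q a \<Lambda>" "kn_Q' a \<Lambda>" "kn_Q'' a \<Lambda>"
  by (rule kn_carter_functions[OF Xi])

lemma u_rho2: "u r (cos \<theta>) = rho2 a r \<theta>"
  by (simp add: u_def rho2_def)

text \<open>\<open>kn_Q\<close> at the cosine is \<open>Delta_theta\<close> times the squared sine,
  which has no zero strictly between the poles.\<close>

lemma chart_kn: "chart = kn_chart a m q \<Lambda>"
proof -
  have "sin \<theta> \<noteq> 0" if "0 < \<theta>" "\<theta> < pi" for \<theta> :: real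
    using sin_gt_zero[OF that] by simp
  then show ?thesis
    unfolding chart_def kn_chart_def kn_Q_cos u_rho2 by auto
qed

lemma kn_metric_coframe:
  assumes x: "x \<in> chart"
  shows "kn_metric a m q \<Lambda> x $ i $ j
    = (\<Sum>A\<in>UNIV. norm2 A (x $ 2) (cos (x $ 3)) * coframe A i x * coframe A j x)"
proof -
  have nz: "sin (x $ 3) \<noteq> 0" "rho2 a (x $ 2) (x $ 3) \<noteq> 0" "Delta_r a m q \<Lambda> (x $ 2) \<noteq> 0"
    "Delta_theta a \<Lambda> (x $ 3) \<noteq> 0"
    using x chart_sin[OF x] by (auto simp: chart_kn kn_chart_def)
  have "\<forall>i j. kn_metric a m q \<Lambda> x $ i $ j
      = (\<Sum>A\<in>UNIV. norm2 A (x $ 2) (cos (x $ 3)) * coframe A i x * coframe A j x)"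
    unfolding forall_4 sum_4 kn_metric_def Let_def coframe_def norm2_def tab_simps kn_Q_cos u_rho2
    using nz Xi
    by (intro conjI; simp add: axis_def; (simp add: divide_simps)?; (simp add: power2_eq_square algebra_simps)?)
  then show ?thesis by blast
qed

interpretation carter_frame a "1 / Xi a \<Lambda>" "Delta_r a m q \<Lambda>" "kn_R' a m \<Lambda>" "kn_R'' a \<Lambda>"
  "kn_Q a \<Lambda>" "kn_Q' a \<Lambda>" "kn_Q'' a \<Lambda>" "kn_metric a m q \<Lambda>"
  by unfold_locales (rule kn_metric_coframe)

text \<open>Both Weyl scalars are linear in \<open>R\<close>, \<open>Q\<close> and their
  derivatives. For m = q = 0 the metric has constant curvature and both vanish, whatever
  \<open>\<Lambda>\<close> is; hence only the part q^2 - 2 m r of \<open>Delta_r\<close>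
  contributes.\<close>

lemma weyl_even_kn:
  assumes "u r c \<noteq> 0"
  shows "weyl_even r c = kn_re a m q r c / (u r c)^3"
proof -
  \<comment> \<open>The common denominator is formed with generic numerators; what then remains is
    the polynomial identity \<open>num\<close>.\<close>
  have cd: "(2 * (A / (2 * v^2) - B / v^3) - (C / (2 * v^2) - E / (2 * v) + F / v^3)
        - (G / (2 * v^2) - H / (2 * v) + F / v^3)) / 6
      = ((2 * A - C - G) * v + (E + H) * v^2 - 2 * B - 2 * (B + 2 * F)) / (12 * v^3)"
    if "v \<noteq> 0" for A B C E F G H v :: real
    using that by (simp add: divide_simps) algebra
  have num: "(2 * (2 * Delta_r a m q \<Lambda> r - r * kn_R' a m \<Lambda> r - 2 * a^2 * kn_Q a \<Lambda> c - a^2 * c * kn_Q' a \<Lambda> c)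
      - (4 * r * kn_R' a m \<Lambda> r - 6 * Delta_r a m q \<Lambda> r + 6 * a^2 * kn_Q a \<Lambda> c)
      - (4 * a^2 * c * kn_Q' a \<Lambda> c - 2 * Delta_r a m q \<Lambda> r + 2 * a^2 * kn_Q a \<Lambda> c)) * u r c
    + (kn_R'' a \<Lambda> r + kn_Q'' a \<Lambda> c) * (u r c)^2
    - 2 * (2 * a^2 * c^2 * (Delta_r a m q \<Lambda> r - a^2 * kn_Q a \<Lambda> c))
    - 2 * (2 * a^2 * c^2 * (Delta_r a m q \<Lambda> r - a^2 * kn_Q a \<Lambda> c)
      + 2 * (4 * a^2 * c^2 * (Delta_r a m q \<Lambda> r - a^2 * kn_Q a \<Lambda> c)))
    = 12 * kn_re a m q r c"
    unfolding u_def Delta_r_def kn_R'_def kn_R''_def kn_Q_def kn_Q'_def kn_Q''_def kn_re_def by algebra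
  show ?thesis
    unfolding weyl_even_def sectional_mixed_def sectional_radial_def sectional_angular_def cd[OF assms] num by simp
qed

lemma weyl_odd_kn:
  assumes "u r c \<noteq> 0"
  shows "weyl_odd r c = - kn_im a m q r c / (u r c)^3"
proof -
  have "A / (2 * v^2) - B / v^3 = (A * v - 2 * B) / (2 * v^3)" if "v \<noteq> 0" for A B v :: real
    using that by (simp add: divide_simps) algebra
  note this[OF assms]
  moreover have "(a * c * kn_R' a m \<Lambda> r - a * r * kn_Q' a \<Lambda> c) * u r c
      - 2 * (2 * a * r * c * (Delta_r a m q \<Lambda> r - a^2 * kn_Q a \<Lambda> c)) = - 2 * kn_im a m q r c"
    unfolding u_def Delta_r_def kn_R'_def kn_Q_def kn_Q'_def kn_im_def by algebra
  ultimately show ?thesis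
    unfolding weyl_odd_def by simp
qed

lemma I6_kn_chart:
  assumes x: "x \<in> kn_chart a m q \<Lambda>"
  shows "I6 (kn_metric a m q \<Lambda>) x = kn_I6 a m q \<Lambda> (x $ 2) (cos (x $ 3))"
proof -
  have k: "96 * weyl_even r c * weyl_odd r c = - 96 * kn_re a m q r c * kn_im a m q r c / (u r c)^6"
    if "u r c \<noteq> 0" for r c
    by (simp add: weyl_even_kn[OF that] weyl_odd_kn[OF that] power_add[symmetric])
  have x': "x \<in> chart"
    using x by (simp add: chart_kn)
  then have "u (x $ 2) (cos (x $ 3)) \<noteq> 0"
    by (simp add: chart_def)
  then show ?thesis
    unfolding kn_I6_def kn_Q_def[symmetric] u_def[symmetric]
    by (intro I6_carter[OF x' k] kn_pontryagin_DERIV[where a = a, folded u_def])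
qed

end

section \<open>Continuous extension beyond the chart\<close>

lemma eventually_Delta_r_nonzero: "\<forall>\<^sub>F s in at r. Delta_r a m q \<Lambda> s \<noteq> 0"
proof -
  define p where "p = [: a^2 + q^2, - 2 * m, 1 - \<Lambda> / 3 * a^2, 0, - \<Lambda> / 3 :]"
  \<comment> \<open>If the leading coefficient vanishes then \<open>\<Lambda>\<close> = 0, and the
    quadratic coefficient is 1.\<close>
  have "p \<noteq> 0"
    by (auto simp: p_def)
  moreover have "Delta_r a m q \<Lambda> s = poly p s" for s
    by (simp add: p_def Delta_r_def power2_eq_square algebra_simps)
  ultimately have "finite {s. Delta_r a m q \<Lambda> s = 0}"
    by (simp add: poly_roots_finite)
  then have "open (- ({s. Delta_r a m q \<Lambda> s = 0} - {r}))"
    by (intro open_Compl finite_imp_closed) simp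
  then show ?thesis
    unfolding eventually_at_topological by (intro exI[of _ "- ({s. Delta_r a m q \<Lambda> s = 0} - {r})"]) auto
qed

text \<open>The point may lie on the axis, on a zero of \<open>Delta_r\<close>, or on both.
  Increasing r leaves the isolated zeros, and a simultaneous change of \<theta> leaves the
  axis.\<close>

lemma kn_chart_islimpt:
  assumes p: "p \<notin> kn_chart a m q \<Lambda>" and \<theta>: "0 \<le> p $ 3" "p $ 3 \<le> pi"
    and nz: "rho2 a (p $ 2) (p $ 3) \<noteq> 0" "Delta_theta a \<Lambda> (p $ 3) \<noteq> 0"
  shows "p islimpt kn_chart a m q \<Lambda>"
proof -
  \<comment> \<open>The inward direction of \<theta> at either pole; away from the poles \<theta>
    stays fixed.\<close>
  define \<sigma> :: real where "\<sigma> = (if p $ 3 = 0 then 1 else if p $ 3 = pi then - 1 else 0)"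
  define \<theta>' where "\<theta>' = (\<lambda>r. p $ 3 + \<sigma> * (r - p $ 2))"
  define path :: "real \<Rightarrow> point" where "path = (\<lambda>r. p + (r - p $ 2) *\<^sub>R (axis 2 1 + \<sigma> *\<^sub>R axis 3 1))"
  have path: "path r $ 2 = r" "path r $ 3 = \<theta>' r" for r
    by (simp_all add: path_def \<theta>'_def axis_def mult.commute)
  have r: "((\<lambda>r. r) \<longlongrightarrow> p $ 2) (at_right (p $ 2))"
    by (rule tendsto_ident_at)
  have \<theta>'_lim: "(\<theta>' \<longlongrightarrow> p $ 3) (at_right (p $ 2))"
    unfolding \<theta>'_def by (rule tendsto_eq_intros r refl | simp)+
  have "(path \<longlongrightarrow> p) (at_right (p $ 2))"
    unfolding path_def by (rule tendsto_eq_intros r refl | simp)+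
  moreover have "\<forall>\<^sub>F r in at_right (p $ 2). path r \<in> kn_chart a m q \<Lambda>"
  proof -
    have "((\<lambda>r. rho2 a r (\<theta>' r)) \<longlongrightarrow> rho2 a (p $ 2) (p $ 3)) (at_right (p $ 2))"
      "((\<lambda>r. Delta_theta a \<Lambda> (\<theta>' r)) \<longlongrightarrow> Delta_theta a \<Lambda> (p $ 3)) (at_right (p $ 2))"
      unfolding rho2_def Delta_theta_def by (intro tendsto_intros r \<theta>'_lim)+
    then have "\<forall>\<^sub>F r in at_right (p $ 2). rho2 a r (\<theta>' r) \<noteq> 0"
      "\<forall>\<^sub>F r in at_right (p $ 2). Delta_theta a \<Lambda> (\<theta>' r) \<noteq> 0"
      using nz by (auto intro: tendsto_imp_eventually_ne)
    moreover have "\<forall>\<^sub>F r in at_right (p $ 2). Delta_r a m q \<Lambda> r \<noteq> 0"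
      by (rule filter_leD[OF at_le[OF subset_UNIV] eventually_Delta_r_nonzero])
    \<comment> \<open>Within a parameter interval of length pi, a path leaving one pole at unit
      speed does not reach the other.\<close>
    moreover have "\<forall>\<^sub>F r in at_right (p $ 2). p $ 2 < r \<and> r < p $ 2 + pi"
      using eventually_at_right_real[of "p $ 2" "p $ 2 + pi"] by simp
    then have "\<forall>\<^sub>F r in at_right (p $ 2). 0 < \<theta>' r \<and> \<theta>' r < pi"
      by (rule eventually_mono) (use \<theta> in \<open>auto simp: \<theta>'_def \<sigma>_def\<close>)
    ultimately show ?thesis
      by eventually_elim (simp add: kn_chart_def path)
  qed
  then have "\<forall>\<^sub>F r in at_right (p $ 2). path r \<in> closure (kn_chart a m q \<Lambda>)"
    by (rule eventually_mono) (use closure_subset in blast)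
  ultimately have "p \<in> closure (kn_chart a m q \<Lambda>)"
    by (intro Lim_in_closed_set[of _ path "at_right (p $ 2)"]) simp_all
  then show ?thesis
    using p by (simp add: islimpt_in_closure)
qed

text \<open>The closed form is continuous at the point in question, which serves the axis and also
  equatorial points at zeros of \<open>Delta_r\<close>, where the coordinate metric degenerates
  too.\<close>

lemma value_by_continuity_kn_I6:
  assumes Xi: "Xi a \<Lambda> \<noteq> 0" and \<theta>: "0 \<le> p $ 3" "p $ 3 \<le> pi"
    and nz: "rho2 a (p $ 2) (p $ 3) \<noteq> 0" "Delta_theta a \<Lambda> (p $ 3) \<noteq> 0"
  shows "value_by_continuity (I6 (kn_metric a m q \<Lambda>)) (kn_chart a m q \<Lambda>) p
    (kn_I6 a m q \<Lambda> (p $ 2) (cos (p $ 3)))"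
proof -
  let ?S = "kn_chart a m q \<Lambda>"
  have coord: "((\<lambda>x. x $ 2) \<longlongrightarrow> p $ 2) (at p within ?S)" "((\<lambda>x. cos (x $ 3)) \<longlongrightarrow> cos (p $ 3)) (at p within ?S)"
    by (intro tendsto_intros tendsto_ident_at)+
  have "((\<lambda>x. kn_I6 a m q \<Lambda> (x $ 2) (cos (x $ 3))) \<longlongrightarrow> kn_I6 a m q \<Lambda> (p $ 2) (cos (p $ 3))) (at p within ?S)"
    unfolding kn_I6_def kn_pontryagin_r_def kn_pontryagin_c_def kn_re_def kn_im_def Delta_r_def
    by (intro tendsto_intros coord) (use nz in \<open>simp_all add: rho2_def\<close>)
  moreover have "\<forall>\<^sub>F x in at p within ?S. kn_I6 a m q \<Lambda> (x $ 2) (cos (x $ 3)) = I6 (kn_metric a m q \<Lambda>) x"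
    unfolding eventually_at_filter by (rule always_eventually) (simp add: I6_kn_chart[OF Xi])
  ultimately have "(I6 (kn_metric a m q \<Lambda>) \<longlongrightarrow> kn_I6 a m q \<Lambda> (p $ 2) (cos (p $ 3))) (at p within ?S)"
    by (rule Lim_transform_eventually)
  then show ?thesis
    unfolding value_by_continuity_def using I6_kn_chart[OF Xi] kn_chart_islimpt[OF _ \<theta> nz] by simp
qed

section \<open>Evaluation on the axis and in the equatorial plane\<close>

lemma kn_I6_axis:
  assumes "a^2 + r^2 \<noteq> 0" "c^2 = 1"
  shows "kn_I6 a m q \<Lambda> r c = - (3072 * (\<Lambda> * a^2 * r^2 + \<Lambda> * r^4 - 3 * a^2 + 6 * m * r - 3 * q^2 - 3 * r^2)
                  / (a^2 + r^2)^15)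
               * (3 * m^2 * a^6 - 63 * r^2 * a^4 * m^2 + 32 * a^4 * m * q^2 * r - 2 * a^4 * q^4
                  + 105 * a^2 * m^2 * r^4 - 120 * a^2 * m * q^2 * r^3 + 28 * r^2 * a^2 * q^4
                  - 21 * m^2 * r^6 + 40 * m * q^2 * r^5 - 18 * q^4 * r^4)^2 * a^2"
    (is "_ = - (3072 * ?D / _) * ?P^2 * a^2")
proof -
  \<comment> \<open>Here 9216 = 96^2, and \<open>Delta_r\<close> = - D / 3 reduces it to 3072; the
    exponent 15 is 14 from the squared derivative plus 1 from the division by u.\<close>
  have quot: "- D / 3 * (9216 * b * p / v^14) / v = - (3072 * D / v^15) * p * b" for D b p v :: real
    using power_Suc2[of v 14] by (simp add: field_simps)
  \<comment> \<open>\<open>c\<close> is 1 or -1, so both poles are treated together; the factor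
    \<open>c\<close> left over disappears on squaring.\<close>
  have c3: "c^3 = c"
    using assms(2) by (simp add: power3_eq_cube power2_eq_square)
  have "kn_pontryagin_r a m q r c = - 96 * c * a * ?P / (a^2 + r^2)^7"
    unfolding kn_pontryagin_r_def kn_re_def kn_im_def assms(2) c3
    by (rule arg_cong2[where f = "(/)"]) (algebra, simp add: add.commute)
  then have "(kn_pontryagin_r a m q r c)\<^sup>2 = 9216 * a^2 * ?P\<^sup>2 / (a^2 + r^2)^14"
    using assms(2) by (simp add: power_divide power_mult_distrib flip: power_mult)
  moreover have "Delta_r a m q \<Lambda> r = - ?D / 3"
    by (simp add: Delta_r_def field_simps power2_eq_square power4_eq_xxxx)
  ultimately have "kn_I6 a m q \<Lambda> r c = - ?D / 3 * (9216 * a^2 * ?P\<^sup>2 / (a^2 + r^2)^14) / (a^2 + r^2)"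
    unfolding kn_I6_def assms(2) by (simp add: add.commute)
  also have "\<dots> = - (3072 * ?D / (a^2 + r^2)^15) * ?P\<^sup>2 * a^2"
    by (rule quot)
  finally show ?thesis .
qed

text \<open>At c = 0 \<open>Delta_r\<close> multiplies a vanishing derivative and the other weight
  is 1, so \<open>\<Lambda>\<close> drops out. The constant is 96^2 * 3^2, the 3 coming from 3 m r -
  2 q^2 = 3 (m r - 2 q^2 / 3).\<close>

lemma kn_I6_equator:
  assumes "r \<noteq> 0"
  shows "kn_I6 a m q \<Lambda> r 0 = 82944 * (m * r - 2 * q^2 / 3)^2 * (m * r - q^2)^2 * a^2 / r^20"
proof -
  have "kn_pontryagin_r a m q r 0 = 0"
    by (simp add: kn_pontryagin_r_def kn_im_def)
  moreover have "kn_pontryagin_c a m q r 0 = - 96 * (q^2 * r^2 - m * r^3) * (2 * q^2 * r * a - 3 * m * r^2 * a) / (r^2)^6"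
    using assms by (simp add: kn_pontryagin_c_def kn_im_def kn_re_def divide_simps) algebra
  ultimately show ?thesis
    using assms by (simp add: kn_I6_def divide_simps) algebra
qed

theorem corollary27:
  fixes a m q \<Lambda> :: real
  assumes "Xi a \<Lambda> \<noteq> 0"
  shows "(\<forall>t r \<theta> \<phi>. a^2 + r^2 \<noteq> 0 \<and> (\<theta> = 0 \<or> \<theta> = pi) \<longrightarrow>
            value_by_continuity (I6 (kn_metric a m q \<Lambda>)) (kn_chart a m q \<Lambda>) (vector [t, r, \<theta>, \<phi>])
             (- (3072 * (\<Lambda> * a^2 * r^2 + \<Lambda> * r^4 - 3 * a^2 + 6 * m * r - 3 * q^2 - 3 * r^2)
                  / (a^2 + r^2)^15)
               * (3 * m^2 * a^6 - 63 * r^2 * a^4 * m^2 + 32 * a^4 * m * q^2 * r - 2 * a^4 * q^4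
                  + 105 * a^2 * m^2 * r^4 - 120 * a^2 * m * q^2 * r^3 + 28 * r^2 * a^2 * q^4
                  - 21 * m^2 * r^6 + 40 * m * q^2 * r^5 - 18 * q^4 * r^4)^2 * a^2)) \<and>
         (\<forall>t r \<phi>. r \<noteq> 0 \<longrightarrow>
            value_by_continuity (I6 (kn_metric a m q \<Lambda>)) (kn_chart a m q \<Lambda>) (vector [t, r, pi/2, \<phi>])
             (82944 * (m * r - 2 * q^2 / 3)^2 * (m * r - q^2)^2 * a^2 / r^20))"
proof (intro conjI allI impI)
  fix t r \<theta> \<phi> :: real
  assume *: "a^2 + r^2 \<noteq> 0 \<and> (\<theta> = 0 \<or> \<theta> = pi)"
  then have "(cos \<theta>)\<^sup>2 = 1"
    by auto
  \<comment> \<open>On the axis \<open>Delta_theta\<close> equals \<open>Xi\<close>, so the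
    hypothesis keeps it away from 0.\<close>
  moreover from this have "rho2 a r \<theta> \<noteq> 0" "Delta_theta a \<Lambda> \<theta> \<noteq> 0"
    using * assms by (auto simp: rho2_def Delta_theta_def Xi_def add.commute)
  ultimately show "value_by_continuity (I6 (kn_metric a m q \<Lambda>)) (kn_chart a m q \<Lambda>) (vector [t, r, \<theta>, \<phi>])
             (- (3072 * (\<Lambda> * a^2 * r^2 + \<Lambda> * r^4 - 3 * a^2 + 6 * m * r - 3 * q^2 - 3 * r^2)
                  / (a^2 + r^2)^15)
               * (3 * m^2 * a^6 - 63 * r^2 * a^4 * m^2 + 32 * a^4 * m * q^2 * r - 2 * a^4 * q^4
                  + 105 * a^2 * m^2 * r^4 - 120 * a^2 * m * q^2 * r^3 + 28 * r^2 * a^2 * q^4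
                  - 21 * m^2 * r^6 + 40 * m * q^2 * r^5 - 18 * q^4 * r^4)^2 * a^2)"
    using value_by_continuity_kn_I6[OF assms, of "vector [t, r, \<theta>, \<phi>]" m q] * kn_I6_axis[of a r "cos \<theta>"]
    by auto
next
  fix t r \<phi> :: real
  assume "r \<noteq> 0"
  then show "value_by_continuity (I6 (kn_metric a m q \<Lambda>)) (kn_chart a m q \<Lambda>) (vector [t, r, pi/2, \<phi>])
             (82944 * (m * r - 2 * q^2 / 3)^2 * (m * r - q^2)^2 * a^2 / r^20)"
    using value_by_continuity_kn_I6[OF assms, of "vector [t, r, pi/2, \<phi>]" m q] kn_I6_equator[of r]
    by (simp add: rho2_def Delta_theta_def)
qed

end
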